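(* For every $n,m\ge 2$, $$\left(C(S^1)_{(n)}\otimes_{\min}C(S^1)_{(m)}\right)_+=(C(S^1)_{(n)})_+\otimes_{{\rm sep}^*}(C(S^1)_{(m)})_+$$ and $$\left(C(S^1)_{(2)}\otimes_{\max}C(S^1)_{(m)}\right)_+=(C(S^1)_{(2)})_+\otimes_{{\rm sep}^*}(C(S^1)_{(m)})_+ .$$
   Context: $C(S^1)_{(n)}$ is the operator subsystem of $C(S^1)$ consisting of all $f(z)=\sum_{\ell=-n+1}^{n-1}\alpha_\ell z^\ell$; a matrix over it is positive iff it is pointwise positive semidefinite on $S^1$. For finite-dimensional operator systems $\mathcal R,\mathcal T$ with order units $e_{\mathcal R},e_{\mathcal T}$: - $\mathcal R_+\otimes_{{\rm sep}^*}\mathcal T_+=\{x\in(\mathcal R\otimes_{\mathbb C}\mathcal T)_{\rm sa} : (\phi\otimes\psi)(x)\ge 0 \text{ for all positive linear functionals }\phi\text{ on }\mathcal R,\ \psi\text{ on }\mathcal T\}$. - $x\in(\mathcal R\otimes_{\min}\mathcal T)_+$ iff $(\phi\otimes\psi)(x)\ge 0$ in $\mathcal M_k(\mathbb C)\otimes\mathcal M_q(\mathbb C)$ for all $k,q\in\mathbb N$ and all unital completely positive maps $\phi:\mathcal R\to\mathcal M_k(\mathbb C)$, $\psi:\mathcal T\to\mathcal M_q(\mathbb C)$. - $x\in(\mathcal R\otimes_{\max}\mathcal T)_+$ iff for every $\varepsilon>0$ there are $k,q\in\mathbb N$, $a\in\mathcal M_k(\mathcal R)_+$, $b\in\mathcal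 M_q(\mathcal T)_+$ and a linear map $\delta:\mathbb C\to\mathbb C^k\otimes\mathbb C^q$ with $\varepsilon(e_{\mathcal R}\otimes e_{\mathcal T})+x=\delta^*(a\otimes b)\delta$. *)

theory Defs
  imports "HOL-Analysis.Analysis" "HOL-Library.Poly_Mapping" "HOL-Library.Function_Algebras"
    "HOL-Library.Complex_Order"
begin

text \<open>
  Matrices are functions of two indices together with a finite index set; entries outside the
  index set are irrelevant. The order \<open>0 \<le> z\<close> on complex numbers means that \<open>z\<close> is
  real and nonnegative, so positive semidefinite matrices are automatically Hermitian.
\<close>

definition psd_on :: "'i set \<Rightarrow> ('i \<Rightarrow> 'i \<Rightarrow> complex) \<Rightarrow> bool" where
  "psd_on I A \<longleftrightarrow> (\<forall>v :: 'i \<Rightarrow> complex. 0 \<le> (\<Sum>i\<in>I. \<Sum>j\<in>I. cnj (v i) * A i j * v j))"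


section \<open>Operator systems\<close>

text \<open>
  \<open>os_pos R k\<close> is the cone of positive matrices in \<open>M\<^sub>k(R)\<close>. The carrier is a complex subspace of
  the ambient type, with addition that of the type and scalar multiplication \<open>os_scale\<close>.
\<close>

record 'a opsys =
  os_carrier :: "'a set"
  os_scale :: "complex \<Rightarrow> 'a \<Rightarrow> 'a"
  os_star :: "'a \<Rightarrow> 'a"
  os_unit :: 'a
  os_pos :: "nat \<Rightarrow> (nat \<Rightarrow> nat \<Rightarrow> 'a) set"

definition os_cone :: "'a opsys \<Rightarrow> 'a set" where
  "os_cone R = {r. (\<lambda>_ _. r) \<in> os_pos R 1}"

text \<open>The operator subsystem on a subspace \<open>S\<close>, with the inherited matrix order.\<close>

definition os_sub :: "'a opsys \<Rightarrow> 'a set \<Rightarrow> 'a opsys" where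
  "os_sub R S = R\<lparr>os_carrier := S,
     os_pos := \<lambda>k. {A \<in> os_pos R k. \<forall>i<k. \<forall>j<k. A i j \<in> S}\<rparr>"

definition linear_functional :: "('a::ab_group_add) opsys \<Rightarrow> ('a \<Rightarrow> complex) \<Rightarrow> bool" where
  "linear_functional R f \<longleftrightarrow>
     (\<forall>x\<in>os_carrier R. \<forall>y\<in>os_carrier R. f (x + y) = f x + f y) \<and>
     (\<forall>c. \<forall>x\<in>os_carrier R. f (os_scale R c x) = c * f x)"

definition positive_functional :: "('a::ab_group_add) opsys \<Rightarrow> ('a \<Rightarrow> complex) \<Rightarrow> bool" where
  "positive_functional R f \<longleftrightarrow> linear_functional R f \<and> (\<forall>r\<in>os_cone R. 0 \<le> f r)"

text \<open>
  Unital completely positive maps \<open>R \<rightarrow> M\<^sub>p(\<complex>)\<close>. A matrix in \<open>M\<^sub>r(M\<^sub>p(\<complex>))\<close> is read as a matrix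
  indexed by \<open>{..<r} \<times> {..<p}\<close>.
\<close>

definition ucp_map :: "('a::ab_group_add) opsys \<Rightarrow> nat \<Rightarrow> ('a \<Rightarrow> nat \<Rightarrow> nat \<Rightarrow> complex) \<Rightarrow> bool" where
  "ucp_map R p \<phi> \<longleftrightarrow>
     (\<forall>i<p. \<forall>j<p. linear_functional R (\<lambda>x. \<phi> x i j)) \<and>
     (\<forall>i<p. \<forall>j<p. \<phi> (os_unit R) i j = (if i = j then 1 else 0)) \<and>
     (\<forall>r. \<forall>A\<in>os_pos R r. psd_on ({..<r} \<times> {..<p}) (\<lambda>(s, i) (t, j). \<phi> (A s t) i j))"


section \<open>The algebraic tensor product\<close>

text \<open>
  \<open>R \<otimes> T\<close> is the free complex vector space on \<open>R \<times> T\<close> modulo the bilinearity relations; its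
  elements are equivalence classes of formal finite sums. \<open>Poly_Mapping.single (a, b) c\<close> represents
  \<open>c (a \<otimes> b)\<close>.
\<close>

definition free_scale :: "complex \<Rightarrow> ('i \<Rightarrow>\<^sub>0 complex) \<Rightarrow> ('i \<Rightarrow>\<^sub>0 complex)" where
  "free_scale c x = Poly_Mapping.map ((*) c) x"

lemma lookup_free_scale [simp]: "Poly_Mapping.lookup (free_scale c x) i = c * Poly_Mapping.lookup x i"
  by (simp add: free_scale_def map.rep_eq when_def)

global_interpretation free_space: vector_space "free_scale :: complex \<Rightarrow> ('i \<Rightarrow>\<^sub>0 complex) \<Rightarrow> _"
  by standard (auto intro!: poly_mapping_eqI simp: lookup_add algebra_simps)

definition tensor_free :: "'a opsys \<Rightarrow> 'b opsys \<Rightarrow> ('a \<times> 'b \<Rightarrow>\<^sub>0 complex) set" where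
  "tensor_free R T = {x. Poly_Mapping.keys x \<subseteq> os_carrier R \<times> os_carrier T}"

definition bilinear_relations ::
  "('a::ab_group_add) opsys \<Rightarrow> ('b::ab_group_add) opsys \<Rightarrow> ('a \<times> 'b \<Rightarrow>\<^sub>0 complex) set" where
  "bilinear_relations R T =
     {Poly_Mapping.single (a + a', b) 1 - Poly_Mapping.single (a, b) 1 - Poly_Mapping.single (a', b) 1
        | a a' b. a \<in> os_carrier R \<and> a' \<in> os_carrier R \<and> b \<in> os_carrier T} \<union>
     {Poly_Mapping.single (a, b + b') 1 - Poly_Mapping.single (a, b) 1 - Poly_Mapping.single (a, b') 1
        | a b b'. a \<in> os_carrier R \<and> b \<in> os_carrier T \<and> b' \<in> os_carrier T} \<union>
     {Poly_Mapping.single (os_scale R c a, b) 1 - Poly_Mapping.single (a, b) c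
        | a b c. a \<in> os_carrier R \<and> b \<in> os_carrier T} \<union>
     {Poly_Mapping.single (a, os_scale T c b) 1 - Poly_Mapping.single (a, b) c
        | a b c. a \<in> os_carrier R \<and> b \<in> os_carrier T}"

definition tensor_eq :: "('a::ab_group_add) opsys \<Rightarrow> ('b::ab_group_add) opsys \<Rightarrow>
    (('a \<times> 'b \<Rightarrow>\<^sub>0 complex) \<times> ('a \<times> 'b \<Rightarrow>\<^sub>0 complex)) set" where
  "tensor_eq R T = {(x, y). x \<in> tensor_free R T \<and> y \<in> tensor_free R T \<and>
     x - y \<in> free_space.span (bilinear_relations R T)}"

definition tensor_space :: "('a::ab_group_add) opsys \<Rightarrow> ('b::ab_group_add) opsys \<Rightarrow>
    ('a \<times> 'b \<Rightarrow>\<^sub>0 complex) set set" where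
  "tensor_space R T = tensor_free R T // tensor_eq R T"

definition tensor_class :: "('a::ab_group_add) opsys \<Rightarrow> ('b::ab_group_add) opsys \<Rightarrow>
    ('a \<times> 'b \<Rightarrow>\<^sub>0 complex) \<Rightarrow> ('a \<times> 'b \<Rightarrow>\<^sub>0 complex) set" where
  "tensor_class R T x = tensor_eq R T `` {x}"

definition tensor_add :: "('i \<Rightarrow>\<^sub>0 complex) set \<Rightarrow> ('i \<Rightarrow>\<^sub>0 complex) set \<Rightarrow> ('i \<Rightarrow>\<^sub>0 complex) set" where
  "tensor_add X Y = {x + y | x y. x \<in> X \<and> y \<in> Y}"

text \<open>The involution determined by \<open>(c (a \<otimes> b))\<^sup>* = cnj c (a\<^sup>* \<otimes> b\<^sup>*)\<close>.\<close>

definition tensor_star :: "'a opsys \<Rightarrow> 'b opsys \<Rightarrow>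
    ('a \<times> 'b \<Rightarrow>\<^sub>0 complex) set \<Rightarrow> ('a \<times> 'b \<Rightarrow>\<^sub>0 complex) set" where
  "tensor_star R T X =
     (\<lambda>x. \<Sum>(a, b)\<in>Poly_Mapping.keys x.
        Poly_Mapping.single (os_star R a, os_star T b) (cnj (Poly_Mapping.lookup x (a, b)))) ` X"

text \<open>
  The functional \<open>f \<otimes> g\<close>. For linear \<open>f\<close> and \<open>g\<close> the sum does not depend on the representative,
  so the image below is a singleton.
\<close>

definition tensor_functional :: "('a \<Rightarrow> complex) \<Rightarrow> ('b \<Rightarrow> complex) \<Rightarrow>
    ('a \<times> 'b \<Rightarrow>\<^sub>0 complex) set \<Rightarrow> complex" where
  "tensor_functional f g X =
     the_elem ((\<lambda>x. \<Sum>(a, b)\<in>Poly_Mapping.keys x. Poly_Mapping.lookup x (a, b) * (f a * g b)) ` X)"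

text \<open>
  The map \<open>\<phi> \<otimes> \<psi>\<close> into \<open>M\<^sub>k(\<complex>) \<otimes> M\<^sub>q(\<complex>)\<close>, whose elements are matrices indexed by pairs: the
  \<open>((i, j), (i', j'))\<close> entry of \<open>A \<otimes> B\<close> is \<open>A i i' * B j j'\<close>.
\<close>

definition tensor_map :: "('a \<Rightarrow> nat \<Rightarrow> nat \<Rightarrow> complex) \<Rightarrow> ('b \<Rightarrow> nat \<Rightarrow> nat \<Rightarrow> complex) \<Rightarrow>
    ('a \<times> 'b \<Rightarrow>\<^sub>0 complex) set \<Rightarrow> nat \<times> nat \<Rightarrow> nat \<times> nat \<Rightarrow> complex" where
  "tensor_map \<phi> \<psi> X =
     (\<lambda>(i, j) (i', j'). tensor_functional (\<lambda>a. \<phi> a i i') (\<lambda>b. \<psi> b j j') X)"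


section \<open>Cones in the tensor product\<close>

definition sep_star_cone :: "('a::ab_group_add) opsys \<Rightarrow> ('b::ab_group_add) opsys \<Rightarrow>
    ('a \<times> 'b \<Rightarrow>\<^sub>0 complex) set set" where
  "sep_star_cone R T = {X \<in> tensor_space R T. tensor_star R T X = X \<and>
     (\<forall>f g. positive_functional R f \<and> positive_functional T g \<longrightarrow> 0 \<le> tensor_functional f g X)}"

definition min_cone :: "('a::ab_group_add) opsys \<Rightarrow> ('b::ab_group_add) opsys \<Rightarrow>
    ('a \<times> 'b \<Rightarrow>\<^sub>0 complex) set set" where
  "min_cone R T = {X \<in> tensor_space R T.
     \<forall>k>0. \<forall>q>0. \<forall>\<phi> \<psi>. ucp_map R k \<phi> \<and> ucp_map T q \<psi> \<longrightarrow>
       psd_on ({..<k} \<times> {..<q}) (tensor_map \<phi> \<psi> X)}"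

text \<open>
  A linear map \<open>\<delta> : \<complex> \<rightarrow> \<complex>\<^sup>k \<otimes> \<complex>\<^sup>q\<close> is given by the coordinates \<open>\<delta> (i, j)\<close> of its value at \<open>1\<close>;
  then \<open>\<delta>\<^sup>*(a \<otimes> b)\<delta>\<close> is the sum of \<open>cnj (\<delta> (i, j)) * \<delta> (i', j')\<close> times
  \<open>a i i' \<otimes> b j j'\<close> over all indices.
\<close>

definition compression :: "nat \<Rightarrow> nat \<Rightarrow> (nat \<times> nat \<Rightarrow> complex) \<Rightarrow>
    (nat \<Rightarrow> nat \<Rightarrow> 'a) \<Rightarrow> (nat \<Rightarrow> nat \<Rightarrow> 'b) \<Rightarrow> ('a \<times> 'b \<Rightarrow>\<^sub>0 complex)" where
  "compression k q \<delta> a b =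
     (\<Sum>(i, j)\<in>{..<k} \<times> {..<q}. \<Sum>(i', j')\<in>{..<k} \<times> {..<q}.
        Poly_Mapping.single (a i i', b j j') (cnj (\<delta> (i, j)) * \<delta> (i', j')))"

definition max_cone :: "('a::ab_group_add) opsys \<Rightarrow> ('b::ab_group_add) opsys \<Rightarrow>
    ('a \<times> 'b \<Rightarrow>\<^sub>0 complex) set set" where
  "max_cone R T = {X \<in> tensor_space R T.
     \<forall>\<epsilon>::real. \<epsilon> > 0 \<longrightarrow> (\<exists>k>0. \<exists>q>0. \<exists>a\<in>os_pos R k. \<exists>b\<in>os_pos T q. \<exists>\<delta>.
       tensor_add (tensor_class R T (Poly_Mapping.single (os_unit R, os_unit T) (complex_of_real \<epsilon>))) X
         = tensor_class R T (compression k q \<delta> a b))}"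


section \<open>Trigonometric polynomials on the circle\<close>

text \<open>
  Functions on the unit circle are represented by functions on \<open>\<complex>\<close> vanishing off the circle, so
  that equality of functions is equality on the circle.
\<close>

definition circle :: "complex set" where
  "circle = sphere 0 1"

definition C_circle :: "(complex \<Rightarrow> complex) opsys" where
  "C_circle =
     (let C = {f. continuous_on circle f \<and> (\<forall>z. z \<notin> circle \<longrightarrow> f z = 0)} in
      \<lparr>os_carrier = C,
       os_scale = \<lambda>c f z. c * f z,
       os_star = \<lambda>f z. cnj (f z),
       os_unit = \<lambda>z. if z \<in> circle then 1 else 0,
       os_pos = \<lambda>k. {A. (\<forall>i<k. \<forall>j<k. A i j \<in> C) \<and> (\<forall>z\<in>circle. psd_on {..<k} (\<lambda>i j. A i j z))}\<rparr>)"

definition trig_polys :: "nat \<Rightarrow> (complex \<Rightarrow> complex) set" where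
  "trig_polys n = {f. \<exists>\<alpha> :: int \<Rightarrow> complex.
     f = (\<lambda>z. if z \<in> circle then \<Sum>l = - int n + 1..int n - 1. \<alpha> l * z powi l else 0)}"

definition C_circle_sub :: "nat \<Rightarrow> (complex \<Rightarrow> complex) opsys" where
  "C_circle_sub n = os_sub C_circle (trig_polys n)"

end

theory Submission
  imports Defs
begin

text \<open>
  Each cone consists of the tensors whose values on the torus are nonnegative. Point evaluations are
  positive functionals and unital completely positive maps, so nonnegative values are necessary for
  the separable-dual and the minimal cone. They are also sufficient: if \<open>F\<close> is nonnegative on the
  torus and \<open>g\<close> is positive on the second factor, then \<open>z \<mapsto> g (F z)\<close> is positive in the first
  factor, and a (completely) positive map can be applied to it. For the maximal cone, necessity is
  the positivity of Kronecker products. When the first factor has degree one, an element is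
  \<open>F(z, w) = cnj (A w) * cnj z + B w + A w * z\<close>, and \<open>F \<ge> 0\<close> on the torus means \<open>2 |A| \<le> B\<close>,
  which is positivity of a \<open>2 \<times> 2\<close> matrix over the second factor and writes \<open>F\<close> explicitly in the
  form required by the maximal cone.
\<close>

section \<open>Formal sums and tensor classes\<close>

text \<open>Linear extension of \<open>h\<close> from the basis to formal sums. With
  \<open>h (a, b) = f a * g b\<close> it is the functional f \<otimes> g computed on a
  representative.\<close>

definition pm_eval :: "('i \<Rightarrow> complex) \<Rightarrow> ('i \<Rightarrow>\<^sub>0 complex) \<Rightarrow> complex" where
  "pm_eval h x = (\<Sum>i\<in>Poly_Mapping.keys x. Poly_Mapping.lookup x i * h i)"

text \<open>Allows formal sums with different supports to be evaluated over one common finite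
  set.\<close>

lemma pm_eval_superset:
  assumes "finite S" "Poly_Mapping.keys x \<subseteq> S"
  shows "pm_eval h x = (\<Sum>i\<in>S. Poly_Mapping.lookup x i * h i)"
  unfolding pm_eval_def using assms
  by (intro sum.mono_neutral_left) (auto simp: in_keys_iff)

lemma pm_eval_0 [simp]: "pm_eval h 0 = 0"
  by (simp add: pm_eval_def)

lemma pm_eval_add [simp]: "pm_eval h (x + y) = pm_eval h x + pm_eval h y"
  and pm_eval_diff [simp]: "pm_eval h (x - y) = pm_eval h x - pm_eval h y"
proof -
  let ?S = "Poly_Mapping.keys x \<union> Poly_Mapping.keys y"
  have S: "finite ?S" by simp
  have "Poly_Mapping.keys (x + y) \<subseteq> ?S" "Poly_Mapping.keys (x - y) \<subseteq> ?S"
    by (auto simp: in_keys_iff lookup_add lookup_minus)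
  then have *: "pm_eval h (x + y) = (\<Sum>i\<in>?S. Poly_Mapping.lookup (x + y) i * h i)"
    "pm_eval h (x - y) = (\<Sum>i\<in>?S. Poly_Mapping.lookup (x - y) i * h i)"
    "pm_eval h x = (\<Sum>i\<in>?S. Poly_Mapping.lookup x i * h i)"
    "pm_eval h y = (\<Sum>i\<in>?S. Poly_Mapping.lookup y i * h i)"
    using pm_eval_superset[OF S] by auto
  show "pm_eval h (x + y) = pm_eval h x + pm_eval h y"
    "pm_eval h (x - y) = pm_eval h x - pm_eval h y"
    unfolding * by (simp_all add: lookup_add lookup_minus algebra_simps sum.distrib sum_subtractf)
qed

lemma pm_eval_single [simp]: "pm_eval h (Poly_Mapping.single i c) = c * h i"
  by (cases "c = 0") (simp_all add: pm_eval_def)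

lemma pm_eval_scale [simp]: "pm_eval h (free_scale c x) = c * pm_eval h x"
proof -
  have "Poly_Mapping.keys (free_scale c x) \<subseteq> Poly_Mapping.keys x"
    by (auto simp: in_keys_iff)
  from pm_eval_superset[OF _ this] show ?thesis
    by (simp add: pm_eval_def sum_distrib_left mult.assoc)
qed

lemma pm_eval_sum [simp]: "pm_eval h (\<Sum>i\<in>I. f i) = (\<Sum>i\<in>I. pm_eval h (f i))"
  by (induction I rule: infinite_finite_induct) auto

lemma sum_single_lookup:
  "(\<Sum>i\<in>Poly_Mapping.keys x. Poly_Mapping.single i (Poly_Mapping.lookup x i)) = x"
  by (rule poly_mapping_eqI) (auto simp: lookup_sum lookup_single when_def in_keys_iff)

section \<open>The quotient by the bilinearity relations and its functionals\<close>

lemma tensor_free_0: "0 \<in> tensor_free R T"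
  by (simp add: tensor_free_def)

lemma tensor_free_add: "x \<in> tensor_free R T \<Longrightarrow> y \<in> tensor_free R T \<Longrightarrow> x + y \<in> tensor_free R T"
  unfolding tensor_free_def using keys_add[of x y] by blast

lemma tensor_free_diff: "x \<in> tensor_free R T \<Longrightarrow> y \<in> tensor_free R T \<Longrightarrow> x - y \<in> tensor_free R T"
  unfolding tensor_free_def using keys_diff[of x y] by blast

lemma tensor_free_sum: "(\<And>i. i \<in> I \<Longrightarrow> f i \<in> tensor_free R T) \<Longrightarrow> (\<Sum>i\<in>I. f i) \<in> tensor_free R T"
  by (induction I rule: infinite_finite_induct)
    (auto intro: tensor_free_add simp: tensor_free_0)

lemma tensor_free_single:
  "a \<in> os_carrier R \<Longrightarrow> b \<in> os_carrier T \<Longrightarrow> Poly_Mapping.single (a, b) c \<in> tensor_free R T"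
  by (auto simp: tensor_free_def)

lemma tensor_free_compression:
  assumes "\<And>i j. i < k \<Longrightarrow> j < k \<Longrightarrow> a i j \<in> os_carrier R"
    and "\<And>i j. i < q \<Longrightarrow> j < q \<Longrightarrow> b i j \<in> os_carrier T"
  shows "compression k q \<delta> a b \<in> tensor_free R T"
  unfolding compression_def using assms by (auto intro!: tensor_free_sum tensor_free_single)

lemma equiv_tensor_eq: "equiv (tensor_free R T) (tensor_eq R T)"
proof (rule equivI)
  show "tensor_eq R T \<subseteq> tensor_free R T \<times> tensor_free R T"
    by (auto simp: tensor_eq_def)
  show "refl_on (tensor_free R T) (tensor_eq R T)"
    by (auto simp: refl_on_def tensor_eq_def free_space.span_zero)
  show "sym (tensor_eq R T)"
    by (auto simp: sym_def tensor_eq_def dest: free_space.span_neg)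
  show "trans (tensor_eq R T)"
    by (auto simp: trans_def tensor_eq_def dest: free_space.span_add)
qed

lemma tensor_spaceE:
  assumes "X \<in> tensor_space R T"
  obtains x where "x \<in> tensor_free R T" "X = tensor_class R T x"
  using assms unfolding tensor_space_def tensor_class_def by (rule quotientE)

lemma tensor_class_in_space: "x \<in> tensor_free R T \<Longrightarrow> tensor_class R T x \<in> tensor_space R T"
  by (auto simp: tensor_space_def tensor_class_def intro: quotientI)

lemma mem_tensor_class_iff:
  "x \<in> tensor_free R T \<Longrightarrow> y \<in> tensor_class R T x \<longleftrightarrow>
     y \<in> tensor_free R T \<and> x - y \<in> free_space.span (bilinear_relations R T)"
  by (auto simp: tensor_class_def tensor_eq_def)

lemma tensor_class_eq_iff:
  "x \<in> tensor_free R T \<Longrightarrow> y \<in> tensor_free R T \<Longrightarrow> tensor_class R T x = tensor_class R T y \<longleftrightarrow>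
     x - y \<in> free_space.span (bilinear_relations R T)"
  unfolding tensor_class_def using eq_equiv_class_iff[OF equiv_tensor_eq, of x R T y]
  by (simp add: tensor_eq_def)

lemma tensor_add_class:
  assumes x: "x \<in> tensor_free R T" and y: "y \<in> tensor_free R T"
  shows "tensor_add (tensor_class R T x) (tensor_class R T y) = tensor_class R T (x + y)"
proof (intro equalityI subsetI)
  fix u assume "u \<in> tensor_add (tensor_class R T x) (tensor_class R T y)"
  then obtain s t where u: "u = s + t" "s \<in> tensor_class R T x" "t \<in> tensor_class R T y"
    by (auto simp: tensor_add_def)
  with x y have "s \<in> tensor_free R T" "t \<in> tensor_free R T"
    "(x - s) + (y - t) \<in> free_space.span (bilinear_relations R T)"
    by (auto simp: mem_tensor_class_iff intro: free_space.span_add)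
  then show "u \<in> tensor_class R T (x + y)"
    using x y u by (simp add: mem_tensor_class_iff tensor_free_add algebra_simps)
next
  fix u assume u: "u \<in> tensor_class R T (x + y)"
  \<comment> \<open>The splitting \<open>u = x + (u - x)\<close> keeps the first summand equal to
    the chosen representative, so only the second must be shown to lie in its class.\<close>
  have "u - x \<in> tensor_free R T"
    using u tensor_free_diff[OF _ x] by (simp add: mem_tensor_class_iff[OF tensor_free_add[OF x y]])
  then have "u - x \<in> tensor_class R T y"
    using u x y by (simp add: mem_tensor_class_iff tensor_free_add algebra_simps)
  moreover have "x \<in> tensor_class R T x"
    using x by (simp add: mem_tensor_class_iff free_space.span_zero)
  ultimately have "x + (u - x) \<in> tensor_add (tensor_class R T x) (tensor_class R T y)"
    unfolding tensor_add_def by (intro CollectI exI[of _ x] exI[of _ "u - x"] conjI refl)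
  then show "u \<in> tensor_add (tensor_class R T x) (tensor_class R T y)" by simp
qed

lemma bilinear_relationsI:
  assumes "a \<in> os_carrier R" "b \<in> os_carrier T"
  shows "a' \<in> os_carrier R \<Longrightarrow> Poly_Mapping.single (a + a', b) 1 - Poly_Mapping.single (a, b) 1
      - Poly_Mapping.single (a', b) 1 \<in> bilinear_relations R T"
    and "b' \<in> os_carrier T \<Longrightarrow> Poly_Mapping.single (a, b + b') 1 - Poly_Mapping.single (a, b) 1
      - Poly_Mapping.single (a, b') 1 \<in> bilinear_relations R T"
    and "Poly_Mapping.single (os_scale R c a, b) 1 - Poly_Mapping.single (a, b) c
      \<in> bilinear_relations R T"
    and "Poly_Mapping.single (a, os_scale T c b) 1 - Poly_Mapping.single (a, b) c
      \<in> bilinear_relations R T"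
  unfolding bilinear_relations_def using assms by blast+

text \<open>The kernel of f \<otimes> g is a subspace and contains each generating relation by
  linearity of \<open>f\<close> and \<open>g\<close>. Evaluations therefore descend to tensor
  classes.\<close>

lemma pm_eval_span_relations:
  assumes f: "linear_functional R f" and g: "linear_functional T g"
    and x: "x \<in> free_space.span (bilinear_relations R T)"
  shows "pm_eval (\<lambda>(a, b). f a * g b) x = 0"
proof -
  let ?K = "{x. pm_eval (\<lambda>(a, b). f a * g b) x = 0}"
  have "free_space.subspace ?K"
    by (rule free_space.subspaceI) auto
  moreover have "bilinear_relations R T \<subseteq> ?K"
    using f g by (auto simp: bilinear_relations_def linear_functional_def distrib_left distrib_right)
  ultimately have "free_space.span (bilinear_relations R T) \<subseteq> ?K"
    by (rule free_space.span_minimal[rotated])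
  with x show ?thesis by blast
qed

text \<open>The evaluation is constant on the class, so the image inside \<open>the_elem\<close> is
  a singleton and any representative computes it.\<close>

lemma tensor_functional_class:
  assumes f: "linear_functional R f" and g: "linear_functional T g" and x: "x \<in> tensor_free R T"
  shows "tensor_functional f g (tensor_class R T x) = pm_eval (\<lambda>(a, b). f a * g b) x"
proof -
  let ?e = "pm_eval (\<lambda>(a, b). f a * g b)"
  have e: "(\<lambda>x. \<Sum>(a, b)\<in>Poly_Mapping.keys x. Poly_Mapping.lookup x (a, b) * (f a * g b)) = ?e"
    by (auto simp: pm_eval_def fun_eq_iff intro!: sum.cong)
  have *: "?e y = ?e x" if "y \<in> tensor_class R T x" for y
    using pm_eval_span_relations[OF f g, of "x - y"] that x by (simp add: mem_tensor_class_iff)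
  have "?e ` tensor_class R T x = (\<lambda>_. ?e x) ` tensor_class R T x"
    by (rule image_cong[OF refl *])
  also have "(\<lambda>_. ?e x) ` tensor_class R T x = {?e x}"
    using x by (intro image_constant[of x]) (simp add: mem_tensor_class_iff free_space.span_zero)
  finally have "?e ` tensor_class R T x = {?e x}" .
  then show ?thesis unfolding tensor_functional_def e by simp
qed

section \<open>Operator systems of functions\<close>

text \<open>Pointwise operations are the essential feature: they allow tensors to be separated by
  their values at pairs of points.\<close>

definition function_system :: "('x \<Rightarrow> complex) opsys \<Rightarrow> bool" where
  "function_system R \<longleftrightarrow> os_scale R = (\<lambda>c f z. c * f z) \<and> 0 \<in> os_carrier R \<and>
     (\<forall>f\<in>os_carrier R. \<forall>g\<in>os_carrier R. f + g \<in> os_carrier R) \<and>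
     (\<forall>c. \<forall>f\<in>os_carrier R. (\<lambda>z. c * f z) \<in> os_carrier R)"

lemma function_system_add:
  "function_system R \<Longrightarrow> f \<in> os_carrier R \<Longrightarrow> g \<in> os_carrier R \<Longrightarrow> f + g \<in> os_carrier R"
  and function_system_scale:
  "function_system R \<Longrightarrow> f \<in> os_carrier R \<Longrightarrow> (\<lambda>z. c * f z) \<in> os_carrier R"
  and function_system_0: "function_system R \<Longrightarrow> 0 \<in> os_carrier R"
  and function_system_os_scale: "function_system R \<Longrightarrow> os_scale R = (\<lambda>c f z. c * f z)"
  by (auto simp: function_system_def)

lemma sum_fun_eq: "(\<lambda>z. \<Sum>i\<in>I. h i z) = (\<Sum>i\<in>I. (h i :: 'x \<Rightarrow> complex))"
  by (rule ext, induction I rule: infinite_finite_induct) auto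

lemma function_system_sum:
  assumes "function_system R" "\<And>i. i \<in> I \<Longrightarrow> h i \<in> os_carrier R"
  shows "(\<lambda>z. \<Sum>i\<in>I. c i * h i z) \<in> os_carrier R"
  unfolding sum_fun_eq[of "\<lambda>i z. c i * h i z"] using assms(2)
  by (induction I rule: infinite_finite_induct)
    (auto intro: function_system_add function_system_scale function_system_0 assms(1))

lemma linear_functional_sum:
  assumes R: "function_system R" and f: "linear_functional R f"
    and h: "\<And>i. i \<in> I \<Longrightarrow> h i \<in> os_carrier R"
  shows "f (\<lambda>z. \<Sum>i\<in>I. c i * h i z) = (\<Sum>i\<in>I. c i * f (h i))"
proof -
  have add: "f (x + y) = f x + f y" if "x \<in> os_carrier R" "y \<in> os_carrier R" for x y
    using f that by (auto simp: linear_functional_def)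
  have scale: "f (\<lambda>z. d * x z) = d * f x" if "x \<in> os_carrier R" for x d
    using f that function_system_os_scale[OF R] by (auto simp: linear_functional_def)
  have f0: "f 0 = 0"
    using add[OF function_system_0[OF R] function_system_0[OF R]] by simp
  show ?thesis
    using h
  proof (induction I rule: infinite_finite_induct)
    case (insert i I)
    have "(\<lambda>z. \<Sum>i\<in>insert i I. c i * h i z) = (\<lambda>z. c i * h i z) + (\<lambda>z. \<Sum>i\<in>I. c i * h i z)"
      using insert by (auto simp: fun_eq_iff)
    then show ?case
      using insert R by (simp add: add scale function_system_scale function_system_sum)
  qed (use f0 in \<open>simp_all add: zero_fun_def\<close>)
qed

text \<open>
  Formal sums of rank-one tensors with vanishing values are relations: if some \<open>b i\<close> has
  \<open>b i w \<noteq> 0\<close>, then evaluating at \<open>w\<close> writes \<open>a i\<close> as a combination of the other \<open>a j\<close>, which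
  shortens the sum.
\<close>

lemma sum_single_in_span:
  assumes R: "function_system R" and T: "function_system T"
    and "finite I" "\<And>i. i \<in> I \<Longrightarrow> a i \<in> os_carrier R" "\<And>i. i \<in> I \<Longrightarrow> b i \<in> os_carrier T"
    and "\<And>z w. (\<Sum>i\<in>I. a i z * b i w) = 0"
  shows "(\<Sum>i\<in>I. Poly_Mapping.single (a i, b i) 1) \<in> free_space.span (bilinear_relations R T)"
  using assms(3-)
\<comment> \<open>The right factors vary because eliminating the index \<open>k\<close> alters every
  remaining \<open>b i\<close>.\<close>
proof (induction I arbitrary: b)
  case empty
  then show ?case by (simp add: free_space.span_zero)
next
  case (insert k I)
  let ?S = "free_space.span (bilinear_relations R T)"
  note base = free_space.span_base[of _ "bilinear_relations R T"]
  have ak: "a k \<in> os_carrier R" and bk: "b k \<in> os_carrier T"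
    and aI: "\<And>i. i \<in> I \<Longrightarrow> a i \<in> os_carrier R" and bI: "\<And>i. i \<in> I \<Longrightarrow> b i \<in> os_carrier T"
    using insert by auto
  note rel = bilinear_relationsI[of _ R _ T, THEN base]
  have scaleL: "Poly_Mapping.single (\<lambda>z. c * f z, g) 1 - Poly_Mapping.single (f, g) c \<in> ?S"
    if "f \<in> os_carrier R" "g \<in> os_carrier T" for f g c
    using rel(3)[OF that] unfolding function_system_os_scale[OF R] .
  have scaleR: "Poly_Mapping.single (f, \<lambda>z. c * g z) 1 - Poly_Mapping.single (f, g) c \<in> ?S"
    if "f \<in> os_carrier R" "g \<in> os_carrier T" for f g c
    using rel(4)[OF that] unfolding function_system_os_scale[OF T] .
  have zeroL: "Poly_Mapping.single (0, g) 1 \<in> ?S" if "g \<in> os_carrier T" for g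
    using scaleL[OF function_system_0[OF R] that, of 0] by (simp add: zero_fun_def)
  have zeroR: "Poly_Mapping.single (f, 0) 1 \<in> ?S" if "f \<in> os_carrier R" for f
    using scaleR[OF that function_system_0[OF T], of 0] by (simp add: zero_fun_def)
  show ?case
  proof (cases "b k = 0")
    case True
    then have "(\<Sum>i\<in>I. Poly_Mapping.single (a i, b i) 1) \<in> ?S"
      using insert by (intro insert.IH) auto
    then show ?thesis
      using insert zeroR[OF ak] True by (auto intro: free_space.span_add)
  next
    case False
    then obtain w where w: "b k w \<noteq> 0" by (auto simp: fun_eq_iff)
    define t where "t i = - (b i w / b k w)" for i
    have ak_eq: "a k = (\<lambda>z. \<Sum>i\<in>I. t i * a i z)"
    proof
      fix z
      have "a k z * b k w + (\<Sum>i\<in>I. a i z * b i w) = 0"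
        using insert.prems(3)[of z w] insert.hyps by simp
      then have "a k z = - (\<Sum>i\<in>I. a i z * b i w) / b k w"
        using w by (simp add: field_simps add_eq_0_iff)
      then show "a k z = (\<Sum>i\<in>I. t i * a i z)"
        by (simp add: t_def sum_divide_distrib sum_negf mult.commute)
    qed
    \<comment> \<open>Substituting the combination for \<open>a k\<close> moves its term onto the
      others: the sum of the \<open>a i\<close> \<otimes> \<open>b' i\<close> over \<open>I\<close>
      has the same values as the whole sum.\<close>
    define b' where "b' i = b i + (\<lambda>z. t i * b k z)" for i
    have tb: "(\<lambda>z. t i * b k z) \<in> os_carrier T" for i
      using T bk by (rule function_system_scale)
    have b': "b' i \<in> os_carrier T" if "i \<in> I" for i
      unfolding b'_def using T bI[OF that] tb by (rule function_system_add)
    have "(\<Sum>i\<in>I. Poly_Mapping.single (a i, b' i) 1) \<in> ?S"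
    proof (rule insert.IH[OF aI b'])
      fix z v
      have "(\<Sum>i\<in>I. a i z * b' i v) = (\<Sum>i\<in>I. a i z * b i v) + (\<Sum>i\<in>I. t i * a i z) * b k v"
        by (simp add: b'_def sum.distrib sum_distrib_left sum_distrib_right algebra_simps)
      also have "\<dots> = (\<Sum>i\<in>insert k I. a i z * b i v)"
        using insert.hyps by (simp add: ak_eq)
      finally show "(\<Sum>i\<in>I. a i z * b' i v) = 0"
        using insert.prems(3) by simp
    qed auto
    moreover have "(\<Sum>i\<in>I. Poly_Mapping.single (a i, b' i) 1 - Poly_Mapping.single (a i, b i) 1
        - Poly_Mapping.single (a i, b k) (t i)) \<in> ?S"
    proof (rule free_space.span_sum)
      fix i assume i: "i \<in> I"
      show "Poly_Mapping.single (a i, b' i) 1 - Poly_Mapping.single (a i, b i) 1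
        - Poly_Mapping.single (a i, b k) (t i) \<in> ?S"
        using free_space.span_add[OF rel(2)[OF aI[OF i] bI[OF i] tb[of i]] scaleR[OF aI[OF i] bk, of "t i"]]
        by (simp add: b'_def algebra_simps)
    qed
    \<comment> \<open>Expands the left factor \<open>a k\<close> modulo the relations. The induction
      runs over subsets \<open>J\<close> of \<open>I\<close>, so the facts about \<open>I\<close>
      stay available.\<close>
    moreover have "Poly_Mapping.single (\<lambda>z. \<Sum>i\<in>J. t i * a i z, b k) 1
        - (\<Sum>i\<in>J. Poly_Mapping.single (a i, b k) (t i)) \<in> ?S" if "finite J" "J \<subseteq> I" for J
      using that
    proof (induction J)
      case empty
      then show ?case using zeroL[OF bk] by (simp add: zero_fun_def)
    next
      case (insert j J)
      have j: "a j \<in> os_carrier R" and J: "\<And>i. i \<in> J \<Longrightarrow> a i \<in> os_carrier R"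
        using insert.prems aI by auto
      have eq: "(\<lambda>z. \<Sum>i\<in>insert j J. t i * a i z) = (\<lambda>z. t j * a j z) + (\<lambda>z. \<Sum>i\<in>J. t i * a i z)"
        using insert.hyps by (auto simp: fun_eq_iff)
      have "Poly_Mapping.single (\<lambda>z. \<Sum>i\<in>J. t i * a i z, b k) 1
        - (\<Sum>i\<in>J. Poly_Mapping.single (a i, b k) (t i)) \<in> ?S"
        using insert by auto
      from free_space.span_add[OF free_space.span_add[OF rel(1)[OF
          function_system_scale[OF R j, of "t j"] bk function_system_sum[where I = J and h = a and c = t, OF R J]]
          scaleL[OF j bk, of "t j"]] this]
      show ?case unfolding eq using insert.hyps by (simp add: algebra_simps)
    qed
    then have "Poly_Mapping.single (a k, b k) 1
        - (\<Sum>i\<in>I. Poly_Mapping.single (a i, b k) (t i)) \<in> ?S"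
      using insert.hyps unfolding ak_eq by blast
    \<comment> \<open>The terms with \<open>b' i\<close> cancel, and so do those with coefficient
      \<open>t i\<close>; what remains is the original sum over \<open>insert k I\<close>.\<close>
    ultimately have "(\<Sum>i\<in>I. Poly_Mapping.single (a i, b' i) 1) -
      (\<Sum>i\<in>I. Poly_Mapping.single (a i, b' i) 1 - Poly_Mapping.single (a i, b i) 1
        - Poly_Mapping.single (a i, b k) (t i)) + (Poly_Mapping.single (a k, b k) 1
        - (\<Sum>i\<in>I. Poly_Mapping.single (a i, b k) (t i))) \<in> ?S"
      by (rule free_space.span_add[OF free_space.span_diff])
    then show ?thesis
      using insert.hyps by (simp add: sum_subtractf sum.distrib algebra_simps)
  qed
qed

text \<open>Converse to \<open>pm_eval_span_relations\<close> for point evaluations: a tensor of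
  functions is determined by its values.\<close>

lemma in_span_relations_if_values_0:
  assumes R: "function_system R" and T: "function_system T" and x: "x \<in> tensor_free R T"
    and 0: "\<And>z w. pm_eval (\<lambda>(a, b). a z * b w) x = 0"
  shows "x \<in> free_space.span (bilinear_relations R T)"
proof -
  let ?S = "free_space.span (bilinear_relations R T)" and ?K = "Poly_Mapping.keys x"
  let ?l = "Poly_Mapping.lookup x"
  \<comment> \<open>The coefficients are absorbed into the left factors, since
    \<open>sum_single_in_span\<close> treats sums with coefficients 1; homogeneity relations account
    for the difference.\<close>
  define a where "a p = (\<lambda>z. ?l p * fst p z)" for p
  have K: "fst p \<in> os_carrier R" "snd p \<in> os_carrier T" if "p \<in> ?K" for p
    using x that by (auto simp: tensor_free_def)
  have "(\<Sum>p\<in>?K. Poly_Mapping.single (a p, snd p) 1) \<in> ?S"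
  proof (rule sum_single_in_span[OF R T])
    show "(\<Sum>p\<in>?K. a p z * snd p w) = 0" for z w
      using 0[of z w] by (simp add: pm_eval_def a_def split_def mult.assoc)
    show "a p \<in> os_carrier R" if "p \<in> ?K" for p
      unfolding a_def using R K[OF that] by (intro function_system_scale)
  qed (use K in auto)
  moreover have "(\<Sum>p\<in>?K. Poly_Mapping.single (a p, snd p) 1 - Poly_Mapping.single p (?l p)) \<in> ?S"
  proof (rule free_space.span_sum, rule free_space.span_base)
    fix p assume "p \<in> ?K"
    from bilinear_relationsI(3)[of _ R _ T, OF K[OF this]]
    show "Poly_Mapping.single (a p, snd p) 1 - Poly_Mapping.single p (?l p) \<in> bilinear_relations R T"
      unfolding a_def function_system_os_scale[OF R] by simp
  qed
  ultimately have "(\<Sum>p\<in>?K. Poly_Mapping.single (a p, snd p) 1) -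
    (\<Sum>p\<in>?K. Poly_Mapping.single (a p, snd p) 1 - Poly_Mapping.single p (?l p)) \<in> ?S"
    by (rule free_space.span_diff)
  then show ?thesis by (simp add: sum_subtractf sum_single_lookup)
qed

text \<open>Collapsing the right factors to numbers by \<open>h\<close> leaves a finite combination
  of left factors, through which a linear \<open>f\<close> passes. Later \<open>h\<close> is a
  functional or a matrix entry of a ucp map.\<close>

lemma slice_left:
  assumes R: "function_system R" and x: "x \<in> tensor_free R T"
  shows "(\<lambda>z. pm_eval (\<lambda>(a, b). a z * h b) x) \<in> os_carrier R"
    and "linear_functional R f \<Longrightarrow>
      f (\<lambda>z. pm_eval (\<lambda>(a, b). a z * h b) x) = pm_eval (\<lambda>(a, b). f a * h b) x"
proof -
  let ?c = "\<lambda>p. Poly_Mapping.lookup x p * h (snd p)" and ?K = "Poly_Mapping.keys x"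
  have K: "fst p \<in> os_carrier R" if "p \<in> ?K" for p
    using x that by (auto simp: tensor_free_def)
  have eq: "(\<lambda>z. pm_eval (\<lambda>(a, b). a z * h b) x) = (\<lambda>z. \<Sum>p\<in>?K. ?c p * fst p z)"
    by (simp add: pm_eval_def split_def mult_ac)
  show "(\<lambda>z. pm_eval (\<lambda>(a, b). a z * h b) x) \<in> os_carrier R"
    unfolding eq by (rule function_system_sum[OF R K])
  show "f (\<lambda>z. pm_eval (\<lambda>(a, b). a z * h b) x) = pm_eval (\<lambda>(a, b). f a * h b) x"
    if f: "linear_functional R f"
  proof -
    have "f (\<lambda>z. \<Sum>p\<in>?K. ?c p * fst p z) = (\<Sum>p\<in>?K. ?c p * f (fst p))"
      by (rule linear_functional_sum[OF R f K])
    then show ?thesis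
      unfolding eq by (simp add: pm_eval_def split_def mult_ac)
  qed
qed

text \<open>Mirror image of \<open>slice_left\<close>; here \<open>h\<close> will be a point
  evaluation or a coefficient function.\<close>

lemma slice_right:
  assumes T: "function_system T" and x: "x \<in> tensor_free R T"
  shows "(\<lambda>w. pm_eval (\<lambda>(a, b). h a * b w) x) \<in> os_carrier T"
    and "linear_functional T g \<Longrightarrow>
      g (\<lambda>w. pm_eval (\<lambda>(a, b). h a * b w) x) = pm_eval (\<lambda>(a, b). h a * g b) x"
proof -
  let ?c = "\<lambda>p. Poly_Mapping.lookup x p * h (fst p)" and ?K = "Poly_Mapping.keys x"
  have K: "snd p \<in> os_carrier T" if "p \<in> ?K" for p
    using x that by (auto simp: tensor_free_def)
  have eq: "(\<lambda>w. pm_eval (\<lambda>(a, b). h a * b w) x) = (\<lambda>w. \<Sum>p\<in>?K. ?c p * snd p w)"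
    by (simp add: pm_eval_def split_def mult_ac)
  show "(\<lambda>w. pm_eval (\<lambda>(a, b). h a * b w) x) \<in> os_carrier T"
    unfolding eq by (rule function_system_sum[OF T K])
  show "g (\<lambda>w. pm_eval (\<lambda>(a, b). h a * b w) x) = pm_eval (\<lambda>(a, b). h a * g b) x"
    if g: "linear_functional T g"
  proof -
    have "g (\<lambda>z. \<Sum>p\<in>?K. ?c p * snd p z) = (\<Sum>p\<in>?K. ?c p * g (snd p))"
      by (rule linear_functional_sum[OF T g K])
    then show ?thesis
      unfolding eq by (simp add: pm_eval_def split_def mult_ac)
  qed
qed

section \<open>Positive semidefinite matrices\<close>

lemma psd_on_cong:
  assumes "\<And>i j. i \<in> I \<Longrightarrow> j \<in> I \<Longrightarrow> A i j = B i j"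
  shows "psd_on I A \<longleftrightarrow> psd_on I B"
  unfolding psd_on_def using assms by (simp cong: sum.cong)

text \<open>Serves to drop a one-point factor from an index set of pairs and to exchange the two
  components.\<close>

lemma psd_on_reindex:
  assumes "inj_on h I" "J = h ` I" "psd_on I (\<lambda>i j. A (h i) (h j))"
  shows "psd_on J A"
  unfolding psd_on_def
proof
  fix v :: "_ \<Rightarrow> complex"
  have "0 \<le> (\<Sum>i\<in>I. \<Sum>j\<in>I. cnj (v (h i)) * A (h i) (h j) * v (h j))"
    using assms(3)[unfolded psd_on_def, rule_format, of "\<lambda>i. v (h i)"] .
  then show "0 \<le> (\<Sum>i\<in>J. \<Sum>j\<in>J. cnj (v i) * A i j * v j)"
    using assms(1,2) by (simp add: sum.reindex)
qed

lemma psd_on_singleton: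
  assumes "psd_on {i} A" shows "0 \<le> A i i"
  using assms[unfolded psd_on_def, rule_format, of "\<lambda>_. 1"] by simp

lemma psd_on_subset:
  assumes "psd_on I A" "J \<subseteq> I" "finite I"
  shows "psd_on J A"
  unfolding psd_on_def
proof
  fix v :: "'a \<Rightarrow> complex"
  let ?u = "\<lambda>i. if i \<in> J then v i else 0"
  have "(\<Sum>i\<in>I. \<Sum>j\<in>I. cnj (?u i) * A i j * ?u j) = (\<Sum>i\<in>J. \<Sum>j\<in>J. cnj (v i) * A i j * v j)"
    using assms(2,3) by (intro sum.mono_neutral_cong_right) auto
  then show "0 \<le> (\<Sum>i\<in>J. \<Sum>j\<in>J. cnj (v i) * A i j * v j)"
    using assms(1)[unfolded psd_on_def, rule_format, of ?u] by (simp only:)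
qed

text \<open>The quadratic form at a vector supported on two indices, with entries \<open>s\<close>
  and \<open>t\<close>.\<close>

lemma psd_on_pair:
  fixes s t :: complex
  assumes "psd_on I A" "i \<in> I" "j \<in> I" "i \<noteq> j" "finite I"
  shows "0 \<le> cnj s * A i i * s + cnj s * A i j * t + cnj t * A j i * s + cnj t * A j j * t"
proof -
  have "psd_on {i, j} A"
    by (rule psd_on_subset[OF assms(1)]) (use assms in auto)
  from this[unfolded psd_on_def, rule_format, of "\<lambda>l. if l = i then s else t"] show ?thesis
    using assms(4) by (simp add: add.assoc)
qed

lemma psd_on_diag:
  assumes "psd_on I A" "i \<in> I" "finite I"
  shows "0 \<le> A i i"
  by (rule psd_on_singleton, rule psd_on_subset[OF assms(1)]) (use assms in auto)

lemma psd_on_hermitian: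
  assumes A: "psd_on I A" and i: "i \<in> I" and j: "j \<in> I" and fin: "finite I"
  shows "A j i = cnj (A i j)"
proof (cases "i = j")
  case True
  then show ?thesis
    using psd_on_diag[OF A i fin] by (simp add: less_eq_complex_def complex_eq_iff)
next
  case False
  note p = psd_on_pair[OF A i j False fin]
  show ?thesis
    \<comment> \<open>Polarization: the diagonal is real, so reality of the form at (1, 1) compares
      the imaginary parts of the two entries, and at (1, \<i>) their real parts.\<close>
    using p[of 1 1] p[of 1 \<i>] psd_on_diag[OF A i fin] psd_on_diag[OF A j fin]
    by (simp add: less_eq_complex_def complex_eq_iff)
qed

text \<open>When \<open>A i i\<close> vanishes, the form is affine along multiples of the i-th
  coordinate, and an affine function bounded below must be constant.\<close>

lemma psd_on_zero_diag:
  assumes A: "psd_on I A" and i: "i \<in> I" and j: "j \<in> I" and fin: "finite I" and 0: "A i i = 0"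
  shows "A i j = 0"
proof (cases "i = j")
  case False
  define N where "N = (cmod (A i j))\<^sup>2"
  define d where "d = Re (A j j)"
  have N: "A i j * cnj (A i j) = of_real N"
    unfolding N_def by (rule complex_norm_square[symmetric])
  have herm: "A j i = cnj (A i j)" by (rule psd_on_hermitian[OF A i j fin])
  have "0 \<le> d" using psd_on_diag[OF A j fin] by (simp add: d_def less_eq_complex_def)
  have "0 \<le> d - 2 * (r * N)" for r
  proof -
    \<comment> \<open>The test vector has i-th entry \<open>- r * A i j\<close> and j-th entry 1, so
      the cross terms add up to \<open>- 2 * r * N\<close>.\<close>
    have "0 \<le> cnj (- of_real r * A i j) * A i i * (- of_real r * A i j)
        + cnj (- of_real r * A i j) * A i j * 1 + cnj 1 * A j i * (- of_real r * A i j)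
        + cnj 1 * A j j * 1"
      by (rule psd_on_pair[OF A i j False fin])
    also have "\<dots> = - of_real (2 * r) * (A i j * cnj (A i j)) + A j j"
      by (simp add: 0 herm algebra_simps)
    finally show ?thesis
      unfolding N by (simp add: less_eq_complex_def d_def)
  qed
  \<comment> \<open>For nonzero \<open>N\<close> this choice of \<open>r\<close> makes the bound
    equal to \<open>- d - 2\<close>, which is negative.\<close>
  from this[of "(d + 1) / N"] \<open>0 \<le> d\<close> have "N = 0"
    by (cases "N = 0") auto
  then show ?thesis by (simp add: N_def)
qed (use 0 in simp)

lemma sum_insert_insert:
  assumes "finite I" "k \<notin> I"
  shows "(\<Sum>i\<in>insert k I. \<Sum>j\<in>insert k I. f i j) =
    f k k + (\<Sum>j\<in>I. f k j) + (\<Sum>i\<in>I. f i k) + (\<Sum>i\<in>I. \<Sum>j\<in>I. (f i j :: 'c :: comm_monoid_add))"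
  using assms by (simp add: sum.distrib ac_simps)

lemma psd_on_schur_complement:
  assumes A: "psd_on (insert k I) A" and fin: "finite I" and k: "k \<notin> I" and nz: "A k k \<noteq> 0"
  shows "psd_on I (\<lambda>i j. A i j - cnj (A k i) * A k j / A k k)"
  unfolding psd_on_def
proof
  fix v :: "'a \<Rightarrow> complex"
  let ?d = "A k k" and ?s = "\<Sum>j\<in>I. A k j * v j"
  \<comment> \<open>Completing the square: this entry at \<open>k\<close> minimises the form for
    given \<open>v\<close>, and the minimum is the form of the Schur complement at
    \<open>v\<close>.\<close>
  define u where "u i = (if i = k then - ?s / ?d else v i)" for i
  have d: "cnj ?d = ?d"
    using psd_on_hermitian[OF A, of k k] fin by simp
  have herm: "A i k = cnj (A k i)" if "i \<in> I" for i
    using psd_on_hermitian[OF A, of k i] fin that by simp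
  have u: "u i = v i" if "i \<in> I" for i
    using that k by (auto simp: u_def)
  have 1: "(\<Sum>j\<in>I. cnj (u k) * A k j * u j) = cnj (u k) * ?s"
    by (simp add: u sum_distrib_left mult.assoc)
  have 2: "(\<Sum>i\<in>I. cnj (u i) * A i k * u k) = cnj ?s * u k"
    by (simp add: u herm sum_distrib_left sum_distrib_right cnj_sum mult_ac)
  have "0 \<le> (\<Sum>i\<in>insert k I. \<Sum>j\<in>insert k I. cnj (u i) * A i j * u j)"
    using A unfolding psd_on_def by blast
  also have "\<dots> = cnj (u k) * ?d * u k + cnj (u k) * ?s + cnj ?s * u k
      + (\<Sum>i\<in>I. \<Sum>j\<in>I. cnj (v i) * A i j * v j)"
    unfolding sum_insert_insert[OF fin k] 1 2 by (simp add: u)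
  also have "cnj (u k) * ?d * u k + cnj (u k) * ?s + cnj ?s * u k = - (cnj ?s * ?s / ?d)"
    using nz by (simp add: u_def d)
  also have "cnj ?s * ?s / ?d = (\<Sum>i\<in>I. \<Sum>j\<in>I. cnj (v i) * (cnj (A k i) * A k j / ?d) * v j)"
    by (simp only: cnj_sum sum_product sum_divide_distrib) (simp add: mult_ac)
  finally show "0 \<le> (\<Sum>i\<in>I. \<Sum>j\<in>I. cnj (v i) * (A i j - cnj (A k i) * A k j / ?d) * v j)"
    by (simp add: algebra_simps sum_subtractf)
qed

text \<open>The Schur product theorem tested on the all-ones vector. A pivot splits \<open>A\<close>
  into its Schur complement, handled by induction, and a rank-one matrix, whose contribution is the
  form of \<open>Q\<close> at the pivot row divided by the pivot.\<close>

lemma psd_on_sum_mult_nonneg: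
  assumes "finite I" "psd_on I A" "psd_on I Q"
  shows "0 \<le> (\<Sum>i\<in>I. \<Sum>j\<in>I. A i j * Q i j)"
  using assms
proof (induction I arbitrary: A)
  case (insert k I)
  let ?d = "A k k"
  have fin: "finite (insert k I)" using insert by simp
  have QI: "psd_on I Q" and AI: "psd_on I A"
    by (rule psd_on_subset[OF insert.prems(2) _ fin] psd_on_subset[OF insert.prems(1) _ fin]; blast)+
  have herm: "A i k = cnj (A k i)" if "i \<in> I" for i
    using psd_on_hermitian[OF insert.prems(1), of k i] fin that by simp
  show ?case
  proof (cases "?d = 0")
    case True
    have 0: "A k j = 0" if "j \<in> I" for j
      using psd_on_zero_diag[OF insert.prems(1), of k j] fin that True by simp
    then have "(\<Sum>i\<in>insert k I. \<Sum>j\<in>insert k I. A i j * Q i j) = (\<Sum>i\<in>I. \<Sum>j\<in>I. A i j * Q i j)"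
      unfolding sum_insert_insert[OF insert.hyps] using True herm by simp
    then show ?thesis using insert.IH[OF AI QI] by simp
  next
    case False
    have d: "0 \<le> ?d" and dc: "cnj ?d = ?d"
      using psd_on_diag[OF insert.prems(1), of k] psd_on_hermitian[OF insert.prems(1), of k k] fin
      by auto
    \<comment> \<open>The Schur complement, taken on the larger index set: its row and column at
      \<open>k\<close> vanish, so summing over \<open>I\<close> or \<open>insert k I\<close> gives
      the same result.\<close>
    define B where "B i j = A i j - cnj (A k i) * A k j / ?d" for i j
    have B0: "B k j = 0" for j
      using False dc by (simp add: B_def)
    have B0': "B i k = 0" if "i \<in> I" for i
      using False herm[OF that] by (simp add: B_def)
    have "0 \<le> (\<Sum>i\<in>I. \<Sum>j\<in>I. B i j * Q i j)"
      unfolding B_def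
      using psd_on_schur_complement[OF insert.prems(1) insert.hyps False] QI by (rule insert.IH)
    also have "\<dots> = (\<Sum>i\<in>insert k I. \<Sum>j\<in>insert k I. B i j * Q i j)"
      unfolding sum_insert_insert[OF insert.hyps] using B0 B0' by simp
    finally have 1: "0 \<le> (\<Sum>i\<in>insert k I. \<Sum>j\<in>insert k I. B i j * Q i j)" .
    have 2: "0 \<le> (\<Sum>i\<in>insert k I. \<Sum>j\<in>insert k I. cnj (A k i) * Q i j * A k j)"
      using insert.prems(2) unfolding psd_on_def by blast
    have "(\<Sum>i\<in>insert k I. \<Sum>j\<in>insert k I. A i j * Q i j) =
      (\<Sum>i\<in>insert k I. \<Sum>j\<in>insert k I. B i j * Q i j + cnj (A k i) * Q i j * A k j / ?d)"
      by (intro sum.cong refl) (simp add: B_def algebra_simps)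
    also have "\<dots> = (\<Sum>i\<in>insert k I. \<Sum>j\<in>insert k I. B i j * Q i j)
      + (\<Sum>i\<in>insert k I. \<Sum>j\<in>insert k I. cnj (A k i) * Q i j * A k j) / ?d"
      by (simp only: sum.distrib sum_divide_distrib)
    also have "0 \<le> \<dots>"
    proof -
      have "0 \<le> S / ?d" if "0 \<le> S" for S
        using that d False dc by (auto simp: less_eq_complex_def Re_divide Im_divide)
      then show ?thesis using 1 2 by (intro add_nonneg_nonneg) auto
    qed
    finally show ?thesis .
  qed
qed simp

text \<open>Summing out the second index pair against \<open>B\<close> turns the form of the
  Kronecker product into an entrywise pairing of \<open>A\<close> with a matrix \<open>Q\<close>, to
  which the Schur product argument applies.\<close>

lemma psd_on_kronecker_form:
  fixes \<delta> :: "nat \<times> nat \<Rightarrow> complex"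
  assumes "psd_on {..<k} A" "psd_on {..<q} B"
  shows "0 \<le> (\<Sum>(i, j)\<in>{..<k} \<times> {..<q}. \<Sum>(i', j')\<in>{..<k} \<times> {..<q}.
    cnj (\<delta> (i, j)) * \<delta> (i', j') * (A i i' * B j j'))"
proof -
  define Q where "Q i i' = (\<Sum>j<q. \<Sum>j'<q. cnj (\<delta> (i, j)) * B j j' * \<delta> (i', j'))" for i i'
  have "psd_on {..<k} Q"
    unfolding psd_on_def
  proof
    fix v :: "nat \<Rightarrow> complex"
    \<comment> \<open>With this vector the form of \<open>Q\<close> at \<open>v\<close> becomes the
      form of \<open>B\<close> at \<open>u\<close>, which shows that \<open>Q\<close> is positive
      semidefinite.\<close>
    define u where "u j = (\<Sum>i<k. \<delta> (i, j) * v i)" for j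
    have "(\<Sum>i<k. \<Sum>i'<k. cnj (v i) * Q i i' * v i') =
        (\<Sum>i<k. \<Sum>i'<k. \<Sum>j<q. \<Sum>j'<q. cnj (\<delta> (i, j) * v i) * B j j' * (\<delta> (i', j') * v i'))"
      by (simp add: Q_def sum_distrib_left sum_distrib_right mult_ac)
    also have "\<dots> = (\<Sum>i<k. \<Sum>j<q. \<Sum>j'<q. \<Sum>i'<k. cnj (\<delta> (i, j) * v i) * B j j' * (\<delta> (i', j') * v i'))"
      by (rule sum.cong[OF refl], rule trans[OF sum.swap], rule sum.cong[OF refl], rule sum.swap)
    also have "\<dots> = (\<Sum>j<q. \<Sum>j'<q. \<Sum>i<k. \<Sum>i'<k. cnj (\<delta> (i, j) * v i) * B j j' * (\<delta> (i', j') * v i'))"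
      by (rule trans[OF sum.swap], rule sum.cong[OF refl], rule sum.swap)
    also have "\<dots> = (\<Sum>j<q. \<Sum>j'<q. cnj (u j) * B j j' * u j')"
      by (simp add: u_def cnj_sum sum_distrib_left sum_distrib_right mult_ac)
    finally show "0 \<le> (\<Sum>i<k. \<Sum>i'<k. cnj (v i) * Q i i' * v i')"
      using assms(2) unfolding psd_on_def by simp
  qed
  then have "0 \<le> (\<Sum>i<k. \<Sum>i'<k. A i i' * Q i i')"
    using assms(1) by (intro psd_on_sum_mult_nonneg) auto
  also have "\<dots> = (\<Sum>i<k. \<Sum>i'<k. \<Sum>j<q. \<Sum>j'<q. cnj (\<delta> (i, j)) * \<delta> (i', j') * (A i i' * B j j'))"
    by (simp add: Q_def sum_distrib_left mult_ac)
  also have "\<dots> = (\<Sum>i<k. \<Sum>j<q. \<Sum>i'<k. \<Sum>j'<q. cnj (\<delta> (i, j)) * \<delta> (i', j') * (A i i' * B j j'))"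
    by (rule sum.cong[OF refl], rule sum.swap)
  finally show ?thesis
    by (simp only: sum.cartesian_product[symmetric])
qed

text \<open>The cross term is at least \<open>- P\<close> times the product of the moduli of the two
  coordinates, and twice that product is at most the sum of their squares.\<close>

lemma psd_on_2x2:
  assumes "2 * cmod c \<le> P"
  shows "psd_on {..<2} (\<lambda>i j. if i = j then of_real (P / 2) else if i = (0::nat) then c else cnj c)"
  unfolding psd_on_def
proof
  fix v :: "nat \<Rightarrow> complex"
  define t where "t = cnj (v 0) * c * v 1"
  let ?x = "cmod (v 0)" and ?y = "cmod (v 1)"
  have P: "0 \<le> P" using assms norm_ge_zero[of c] by linarith
  have two: "{..<2} = {0, 1 :: nat}" by auto
  have "(\<Sum>i<2. \<Sum>j<2. cnj (v i) * (if i = j then of_real (P / 2) else if i = (0::nat) then c else cnj c) * v j)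
      = of_real (P / 2) * (v 0 * cnj (v 0)) + of_real (P / 2) * (v 1 * cnj (v 1)) + (t + cnj t)"
    unfolding two by (simp add: t_def algebra_simps)
  also have "\<dots> = of_real (P / 2 * ?x\<^sup>2 + P / 2 * ?y\<^sup>2 + 2 * Re t)"
    by (simp only: complex_norm_square[symmetric] complex_add_cnj of_real_add of_real_mult)
  finally have eq: "(\<Sum>i<2. \<Sum>j<2. cnj (v i) *
      (if i = j then of_real (P / 2) else if i = (0::nat) then c else cnj c) * v j) = \<dots>" .
  have "- Re t \<le> cmod t" using abs_Re_le_cmod[of t] by linarith
  also have "cmod t = cmod c * (?x * ?y)" by (simp add: t_def norm_mult)
  also have "\<dots> \<le> P / 2 * (?x * ?y)"
    using assms by (intro mult_right_mono) auto
  finally have "- (2 * Re t) \<le> P / 2 * (2 * (?x * ?y))" by simp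
  also have "\<dots> \<le> P / 2 * (?x\<^sup>2 + ?y\<^sup>2)"
    using P sum_squares_bound[of ?x ?y] by (intro mult_left_mono) (auto simp: mult_ac)
  finally show "0 \<le> (\<Sum>i<2. \<Sum>j<2. cnj (v i) *
      (if i = j then of_real (P / 2) else if i = (0::nat) then c else cnj c) * v j)"
    unfolding eq by (simp add: less_eq_complex_def algebra_simps)
qed

section \<open>Trigonometric polynomials\<close>

lemma trig_polys_eq_0: "f \<in> trig_polys n \<Longrightarrow> z \<notin> circle \<Longrightarrow> f z = 0"
  by (auto simp: trig_polys_def)

lemma monomial_in_trig_polys:
  assumes "\<bar>l\<bar> < int n"
  shows "(\<lambda>z. if z \<in> circle then z powi l else 0) \<in> trig_polys n"
proof -
  have "(\<Sum>j = - int n + 1..int n - 1. (if j = l then 1 else 0) * z powi j) = z powi l" for z :: complex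
    using assms by (auto simp: if_distrib[of "\<lambda>x. x * _"] abs_less_iff cong: if_cong)
  then show ?thesis
    unfolding trig_polys_def by (intro CollectI exI[of _ "\<lambda>j. if j = l then 1 else 0"])
      (auto simp: fun_eq_iff)
qed

lemma trig_polys_add: "f \<in> trig_polys n \<Longrightarrow> g \<in> trig_polys n \<Longrightarrow> f + g \<in> trig_polys n"
proof -
  assume "f \<in> trig_polys n" "g \<in> trig_polys n"
  then obtain \<alpha> \<beta> where
    "f = (\<lambda>z. if z \<in> circle then \<Sum>l = - int n + 1..int n - 1. \<alpha> l * z powi l else 0)"
    "g = (\<lambda>z. if z \<in> circle then \<Sum>l = - int n + 1..int n - 1. \<beta> l * z powi l else 0)"
    unfolding trig_polys_def by blast
  then show ?thesis
    unfolding trig_polys_def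
    by (intro CollectI exI[of _ "\<lambda>l. \<alpha> l + \<beta> l"]) (auto simp: fun_eq_iff distrib_right sum.distrib)
qed

lemma trig_polys_scale: "f \<in> trig_polys n \<Longrightarrow> (\<lambda>z. c * f z) \<in> trig_polys n"
proof -
  assume "f \<in> trig_polys n"
  then obtain \<alpha> where
    "f = (\<lambda>z. if z \<in> circle then \<Sum>l = - int n + 1..int n - 1. \<alpha> l * z powi l else 0)"
    unfolding trig_polys_def by blast
  then show ?thesis
    unfolding trig_polys_def
    by (intro CollectI exI[of _ "\<lambda>l. c * \<alpha> l"]) (auto simp: fun_eq_iff mult.assoc sum_distrib_left)
qed

lemma trig_polys_0: "0 \<in> trig_polys n"
  unfolding trig_polys_def by (intro CollectI exI[of _ "\<lambda>_. 0"]) (auto simp: fun_eq_iff)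

text \<open>On the unit circle conjugation is inversion.\<close>

lemma cnj_powi_circle:
  assumes "z \<in> circle" shows "cnj (z powi l) = z powi (- l)"
proof -
  have "inverse z = cnj z"
    using assms by (simp add: circle_def inverse_eq_divide complex_div_cnj[of 1 z])
  then show ?thesis
    by (simp add: power_int_minus flip: power_int_inverse)
qed

lemma trig_polys_cnj: "f \<in> trig_polys n \<Longrightarrow> (\<lambda>z. cnj (f z)) \<in> trig_polys n"
proof -
  let ?I = "{- int n + 1..int n - 1}"
  assume "f \<in> trig_polys n"
  then obtain \<alpha> where f: "f = (\<lambda>z. if z \<in> circle then \<Sum>l\<in>?I. \<alpha> l * z powi l else 0)"
    unfolding trig_polys_def by blast
  have "cnj (\<Sum>l\<in>?I. \<alpha> l * z powi l) = (\<Sum>l\<in>?I. cnj (\<alpha> (- l)) * z powi l)" if "z \<in> circle" for z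
  proof -
    have "cnj (\<Sum>l\<in>?I. \<alpha> l * z powi l) = (\<Sum>l\<in>?I. cnj (\<alpha> l) * z powi (- l))"
      by (simp add: cnj_powi_circle[OF that, simplified])
    also have "\<dots> = (\<Sum>l\<in>?I. cnj (\<alpha> (- l)) * z powi l)"
      \<comment> \<open>The range of exponents is symmetric about 0, so negation permutes
        it.\<close>
      by (rule sum.reindex_bij_witness[of _ uminus uminus]) auto
    finally show ?thesis .
  qed
  then show ?thesis
    unfolding trig_polys_def f by (intro CollectI exI[of _ "\<lambda>l. cnj (\<alpha> (- l))"]) auto
qed

lemma trig_polys_continuous: "f \<in> trig_polys n \<Longrightarrow> continuous_on circle f"
proof -
  assume "f \<in> trig_polys n"
  then obtain \<alpha> where
    f: "f = (\<lambda>z. if z \<in> circle then \<Sum>l = - int n + 1..int n - 1. \<alpha> l * z powi l else 0)"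
    unfolding trig_polys_def by blast
  have "continuous_on circle (\<lambda>z. \<Sum>l = - int n + 1..int n - 1. \<alpha> l * z powi l)"
    by (intro continuous_intros) (auto simp: circle_def)
  then show ?thesis
    unfolding f by (rule continuous_on_eq) auto
qed

text \<open>The three functions arise by choosing coefficients for each polynomial separately; the
  value formula is what is recorded of them, and \<open>slice_right\<close> accepts arbitrary
  functions of the left factor.\<close>

lemma trig_polys_2_coefficients:
  "\<exists>p q r. \<forall>f\<in>trig_polys 2. \<forall>z\<in>circle. f z = p f * cnj z + q f + r f * z"
proof -
  have I: "{- 1..1 :: int} = {- 1, 0, 1}" by auto
  have "\<forall>f\<in>trig_polys 2. \<exists>\<alpha>.
      f = (\<lambda>z. if z \<in> circle then \<Sum>l = - int 2 + 1..int 2 - 1. \<alpha> l * z powi l else 0)"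
    by (simp add: trig_polys_def)
  from bchoice[OF this] obtain \<alpha> where \<alpha>: "\<And>f. f \<in> trig_polys 2 \<Longrightarrow>
      f = (\<lambda>z. if z \<in> circle then \<Sum>l = - int 2 + 1..int 2 - 1. \<alpha> f l * z powi l else 0)"
    by blast
  show ?thesis
  proof (rule exI[of _ "\<lambda>f. \<alpha> f (- 1)"], rule exI[of _ "\<lambda>f. \<alpha> f 0"],
      rule exI[of _ "\<lambda>f. \<alpha> f 1"], intro ballI)
    fix f z assume f: "f \<in> trig_polys 2" and z: "z \<in> circle"
    from fun_cong[OF \<alpha>[OF f], of z] show "f z = \<alpha> f (- 1) * cnj z + \<alpha> f 0 + \<alpha> f 1 * z"
      using z cnj_powi_circle[OF z, of 1] by (simp add: I)
  qed
qed

lemma C_circle_sub_simps [simp]: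
  "os_carrier (C_circle_sub n) = trig_polys n"
  "os_star (C_circle_sub n) = (\<lambda>f z. cnj (f z))"
  "os_unit (C_circle_sub n) = (\<lambda>z. if z \<in> circle then 1 else 0)"
  by (simp_all add: C_circle_sub_def os_sub_def C_circle_def Let_def)

lemma function_system_C_circle_sub [simp]: "function_system (C_circle_sub n)"
  by (auto simp: function_system_def trig_polys_add trig_polys_scale trig_polys_0)
    (simp add: C_circle_sub_def os_sub_def C_circle_def Let_def)

lemma unit_in_trig_polys: "n > 0 \<Longrightarrow> (\<lambda>z. if z \<in> circle then 1 else 0) \<in> trig_polys n"
  using monomial_in_trig_polys[of 0 n] by (simp cong: if_cong)

text \<open>Continuity and vanishing off the circle, demanded by the ambient system, are automatic
  for trigonometric polynomials.\<close>

lemma os_pos_C_circle_sub: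
  "A \<in> os_pos (C_circle_sub n) k \<longleftrightarrow> (\<forall>i<k. \<forall>j<k. A i j \<in> trig_polys n) \<and>
     (\<forall>z\<in>circle. psd_on {..<k} (\<lambda>i j. A i j z))"
  by (auto simp: C_circle_sub_def os_sub_def C_circle_def Let_def
      intro: trig_polys_continuous trig_polys_eq_0)

lemma psd_on_1: "psd_on {..<Suc 0} (\<lambda>_ _. c) \<longleftrightarrow> 0 \<le> c"
proof
  assume "psd_on {..<Suc 0} (\<lambda>_ _. c)"
  then show "0 \<le> c" using psd_on_diag[of "{..<Suc 0}" "\<lambda>_ _. c" 0] by simp
next
  assume c: "0 \<le> c"
  have "0 \<le> cnj v * c * v" for v
  proof -
    have "0 \<le> complex_of_real ((cmod v)\<^sup>2) * c"
      using c by (simp add: less_eq_complex_def)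
    also have "\<dots> = cnj v * c * v"
      unfolding complex_norm_square by (simp add: mult_ac)
    finally show ?thesis .
  qed
  then show "psd_on {..<Suc 0} (\<lambda>_ _. c)"
    by (simp add: psd_on_def)
qed

lemma os_cone_C_circle_sub:
  "r \<in> os_cone (C_circle_sub n) \<longleftrightarrow> r \<in> trig_polys n \<and> (\<forall>z\<in>circle. 0 \<le> r z)"
  by (simp add: os_cone_def os_pos_C_circle_sub psd_on_1)

lemma linear_functional_point [simp]: "linear_functional (C_circle_sub n) (\<lambda>a. a z)"
  using function_system_os_scale[OF function_system_C_circle_sub]
  by (simp add: linear_functional_def)

section \<open>Comparison with positivity on the torus\<close>

text \<open>The cone with which all others are compared. One nonnegative representative suffices,
  since values at points depend only on the class.\<close>

definition torus_cone :: "nat \<Rightarrow> nat \<Rightarrow>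
    ((complex \<Rightarrow> complex) \<times> (complex \<Rightarrow> complex) \<Rightarrow>\<^sub>0 complex) set set" where
  "torus_cone n m = {tensor_class (C_circle_sub n) (C_circle_sub m) x | x.
     x \<in> tensor_free (C_circle_sub n) (C_circle_sub m) \<and>
     (\<forall>z\<in>circle. \<forall>w\<in>circle. 0 \<le> pm_eval (\<lambda>(a, b). a z * b w) x)}"

lemma torus_coneI:
  assumes "x \<in> tensor_free (C_circle_sub n) (C_circle_sub m)"
    and "\<And>z w. z \<in> circle \<Longrightarrow> w \<in> circle \<Longrightarrow> 0 \<le> pm_eval (\<lambda>(a, b). a z * b w) x"
  shows "tensor_class (C_circle_sub n) (C_circle_sub m) x \<in> torus_cone n m"
  unfolding torus_cone_def using assms by (intro CollectI exI[of _ x]) simp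

lemma tensor_class_eqI:
  assumes x: "x \<in> tensor_free (C_circle_sub n) (C_circle_sub m)"
    and y: "y \<in> tensor_free (C_circle_sub n) (C_circle_sub m)"
    and eq: "\<And>z w. z \<in> circle \<Longrightarrow> w \<in> circle \<Longrightarrow>
      pm_eval (\<lambda>(a, b). a z * b w) x = pm_eval (\<lambda>(a, b). a z * b w) y"
  shows "tensor_class (C_circle_sub n) (C_circle_sub m) x = tensor_class (C_circle_sub n) (C_circle_sub m) y"
  unfolding tensor_class_eq_iff[OF x y]
proof (rule in_span_relations_if_values_0)
  show xy: "x - y \<in> tensor_free (C_circle_sub n) (C_circle_sub m)"
    by (rule tensor_free_diff[OF x y])
  show "pm_eval (\<lambda>(a, b). a z * b w) (x - y) = 0" for z w
  proof (cases "z \<in> circle \<and> w \<in> circle")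
    case True
    then show ?thesis using eq by simp
  next
    \<comment> \<open>Functions are extended by 0 off the circle, so every summand vanishes outside
      the torus.\<close>
    case False
    have "fst p z * snd p w = 0" if "p \<in> Poly_Mapping.keys (x - y)" for p
    proof -
      have "fst p \<in> trig_polys n" "snd p \<in> trig_polys m"
        using xy that by (auto simp: tensor_free_def)
      then show ?thesis using False trig_polys_eq_0 by auto
    qed
    then show ?thesis
      unfolding pm_eval_def by (intro sum.neutral) (auto simp: split_def)
  qed
qed simp_all

section \<open>The separable-dual cone\<close>

lemma positive_functional_torus:
  assumes x: "x \<in> tensor_free (C_circle_sub n) (C_circle_sub m)"
    and pos: "\<And>z w. z \<in> circle \<Longrightarrow> w \<in> circle \<Longrightarrow> 0 \<le> pm_eval (\<lambda>(a, b). a z * b w) x"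
    and f: "positive_functional (C_circle_sub n) f" and g: "positive_functional (C_circle_sub m) g"
  shows "0 \<le> pm_eval (\<lambda>(a, b). f a * g b) x"
proof -
  have fl: "linear_functional (C_circle_sub n) f" and gl: "linear_functional (C_circle_sub m) g"
    using f g by (auto simp: positive_functional_def)
  \<comment> \<open>The functionals are applied one at a time: \<open>g\<close> to the slice at
    fixed \<open>z\<close>, then \<open>f\<close> to the resulting function of
    \<open>z\<close>.\<close>
  have "0 \<le> pm_eval (\<lambda>(a, b). a z * g b) x" if z: "z \<in> circle" for z
  proof -
    have "(\<lambda>w. pm_eval (\<lambda>(a, b). a z * b w) x) \<in> os_cone (C_circle_sub m)"
      using slice_right(1)[OF function_system_C_circle_sub x, of "\<lambda>a. a z"] pos z
      by (simp add: os_cone_C_circle_sub)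
    then show ?thesis
      using g slice_right(2)[OF function_system_C_circle_sub x gl, of "\<lambda>a. a z"]
      unfolding positive_functional_def by metis
  qed
  then have "(\<lambda>z. pm_eval (\<lambda>(a, b). a z * g b) x) \<in> os_cone (C_circle_sub n)"
    using slice_left(1)[OF function_system_C_circle_sub x, of g]
    by (simp add: os_cone_C_circle_sub)
  then show ?thesis
    using f slice_left(2)[OF function_system_C_circle_sub x fl, of g]
    unfolding positive_functional_def by metis
qed

text \<open>On values the involution is complex conjugation, which fixes nonnegative numbers; on the
  torus values determine the class.\<close>

lemma tensor_star_torus:
  assumes x: "x \<in> tensor_free (C_circle_sub n) (C_circle_sub m)"
    and pos: "\<And>z w. z \<in> circle \<Longrightarrow> w \<in> circle \<Longrightarrow> 0 \<le> pm_eval (\<lambda>(a, b). a z * b w) x"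
  shows "tensor_star (C_circle_sub n) (C_circle_sub m) (tensor_class (C_circle_sub n) (C_circle_sub m) x)
    = tensor_class (C_circle_sub n) (C_circle_sub m) x"
proof -
  let ?R = "C_circle_sub n" and ?T = "C_circle_sub m"
  let ?X = "tensor_class ?R ?T x"
  define \<sigma> :: "(complex \<Rightarrow> complex) \<times> (complex \<Rightarrow> complex) \<Rightarrow> (complex \<Rightarrow> complex) \<times> (complex \<Rightarrow> complex)"
    where "\<sigma> = (\<lambda>(a, b). (\<lambda>z. cnj (a z), \<lambda>z. cnj (b z)))"
  define star where "star y = (\<Sum>p\<in>Poly_Mapping.keys y.
    Poly_Mapping.single (\<sigma> p) (cnj (Poly_Mapping.lookup y p)))" for y
  have star_image: "tensor_star ?R ?T Y = star ` Y" for Y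
    unfolding tensor_star_def star_def \<sigma>_def by (simp add: split_def)
  have \<sigma>\<sigma>: "\<sigma> (\<sigma> p) = p" for p by (cases p) (simp add: \<sigma>_def)
  have \<sigma>_eq: "\<sigma> p = q \<longleftrightarrow> p = \<sigma> q" for p q using \<sigma>\<sigma> by metis
  \<comment> \<open>\<open>\<sigma>\<close> is a bijection of the basis, so no two terms of the
    starred sum collide.\<close>
  have lookup_star: "Poly_Mapping.lookup (star y) q = cnj (Poly_Mapping.lookup y (\<sigma> q))" for y q
    unfolding star_def
    by (auto simp: lookup_sum lookup_single when_def \<sigma>_eq in_keys_iff)
  have star_star: "star (star y) = y" for y
    by (rule poly_mapping_eqI) (simp add: lookup_star \<sigma>\<sigma>)
  have star_mem: "star y \<in> ?X" if y: "y \<in> ?X" for y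
  proof -
    have yf: "y \<in> tensor_free ?R ?T" and xy: "x - y \<in> free_space.span (bilinear_relations ?R ?T)"
      using y by (auto simp: mem_tensor_class_iff[OF x])
    have sf: "star y \<in> tensor_free ?R ?T"
      unfolding star_def
      using yf by (intro tensor_free_sum) (auto simp: tensor_free_def \<sigma>_def intro: trig_polys_cnj)
    have "pm_eval (\<lambda>(a, b). a z * b w) x = pm_eval (\<lambda>(a, b). a z * b w) (star y)"
      if zw: "z \<in> circle" "w \<in> circle" for z w
    proof -
      have "pm_eval (\<lambda>(a, b). a z * b w) (star y) = cnj (pm_eval (\<lambda>(a, b). a z * b w) y)"
        unfolding star_def by (simp add: pm_eval_def[of _ y] \<sigma>_def split_def)
      also have "pm_eval (\<lambda>(a, b). a z * b w) y = pm_eval (\<lambda>(a, b). a z * b w) x"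
        using pm_eval_span_relations[OF linear_functional_point linear_functional_point xy] by simp
      also have "cnj \<dots> = \<dots>"
        using pos[OF zw] by (auto simp: less_eq_complex_def complex_eq_iff)
      finally show ?thesis by simp
    qed
    then have "?X = tensor_class ?R ?T (star y)"
      by (rule tensor_class_eqI[OF x sf])
    then show ?thesis
      using sf by (simp add: mem_tensor_class_iff free_space.span_zero)
  qed
  have "star ` ?X = ?X"
  proof
    show "star ` ?X \<subseteq> ?X" using star_mem by blast
    \<comment> \<open>A self-inverse map of the class into itself is onto.\<close>
    show "?X \<subseteq> star ` ?X"
      using star_mem star_star by (metis image_eqI subsetI)
  qed
  then show ?thesis by (simp add: star_image)
qed

lemma sep_star_cone_eq: "sep_star_cone (C_circle_sub n) (C_circle_sub m) = torus_cone n m"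
proof (intro equalityI subsetI)
  fix X assume X: "X \<in> sep_star_cone (C_circle_sub n) (C_circle_sub m)"
  then obtain x where x: "x \<in> tensor_free (C_circle_sub n) (C_circle_sub m)"
    and Xx: "X = tensor_class (C_circle_sub n) (C_circle_sub m) x"
    unfolding sep_star_cone_def by (blast elim: tensor_spaceE)
  have "0 \<le> pm_eval (\<lambda>(a, b). a z * b w) x" if "z \<in> circle" "w \<in> circle" for z w
  proof -
    have "positive_functional (C_circle_sub n) (\<lambda>a. a z)" "positive_functional (C_circle_sub m) (\<lambda>a. a w)"
      using that by (auto simp: positive_functional_def os_cone_C_circle_sub)
    then have "0 \<le> tensor_functional (\<lambda>a. a z) (\<lambda>b. b w) X"
      using X unfolding sep_star_cone_def by blast
    then show ?thesis by (simp add: Xx x tensor_functional_class)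
  qed
  then show "X \<in> torus_cone n m"
    unfolding Xx by (rule torus_coneI[OF x])
next
  fix X assume "X \<in> torus_cone n m"
  then obtain x where x: "x \<in> tensor_free (C_circle_sub n) (C_circle_sub m)"
    and Xx: "X = tensor_class (C_circle_sub n) (C_circle_sub m) x"
    and "\<forall>z\<in>circle. \<forall>w\<in>circle. 0 \<le> pm_eval (\<lambda>(a, b). a z * b w) x"
    unfolding torus_cone_def mem_Collect_eq by (elim exE conjE)
  then have pos: "0 \<le> pm_eval (\<lambda>(a, b). a z * b w) x" if "z \<in> circle" "w \<in> circle" for z w
    using that by simp
  show "X \<in> sep_star_cone (C_circle_sub n) (C_circle_sub m)"
    unfolding sep_star_cone_def
  proof (intro CollectI conjI allI impI)
    show "X \<in> tensor_space (C_circle_sub n) (C_circle_sub m)"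
      unfolding Xx by (rule tensor_class_in_space[OF x])
    show "tensor_star (C_circle_sub n) (C_circle_sub m) X = X"
      unfolding Xx by (rule tensor_star_torus[OF x pos])
    fix f g
    assume fg: "positive_functional (C_circle_sub n) f \<and> positive_functional (C_circle_sub m) g"
    then have "linear_functional (C_circle_sub n) f" "linear_functional (C_circle_sub m) g"
      by (auto simp: positive_functional_def)
    then show "0 \<le> tensor_functional f g X"
      unfolding Xx using positive_functional_torus[OF x pos] fg
      by (simp add: tensor_functional_class x)
  qed
qed

section \<open>The minimal cone\<close>

lemma ucp_map_point:
  assumes "z \<in> circle"
  shows "ucp_map (C_circle_sub n) 1 (\<lambda>a _ _. a z)"
  unfolding ucp_map_def
proof (intro conjI allI impI ballI)
  fix r A assume "A \<in> os_pos (C_circle_sub n) r"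
  then have A: "psd_on {..<r} (\<lambda>s t. A s t z)"
    using assms by (simp add: os_pos_C_circle_sub)
  have eq: "{..<r} \<times> {..<1} = (\<lambda>s. (s, 0 :: nat)) ` {..<r}" by auto
  show "psd_on ({..<r} \<times> {..<1 :: nat}) (\<lambda>(s, i) (t, j). A s t z)"
    by (rule psd_on_reindex[of "\<lambda>s. (s, 0 :: nat)" "{..<r}"]) (use A eq in \<open>auto simp: inj_on_def\<close>)
qed (use assms in auto)

text \<open>
  Applying \<open>\<psi>\<close> in the second variable gives a matrix of functions that is positive because \<open>\<psi>\<close> is
  positive, to which the completely positive \<open>\<phi>\<close> is applied entrywise.
\<close>

lemma ucp_tensor_torus:
  assumes x: "x \<in> tensor_free (C_circle_sub n) (C_circle_sub m)"
    and pos: "\<And>z w. z \<in> circle \<Longrightarrow> w \<in> circle \<Longrightarrow> 0 \<le> pm_eval (\<lambda>(a, b). a z * b w) x"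
    and \<phi>: "ucp_map (C_circle_sub n) k \<phi>" and \<psi>: "ucp_map (C_circle_sub m) q \<psi>"
  shows "psd_on ({..<k} \<times> {..<q})
    (\<lambda>(i, j) (i', j'). pm_eval (\<lambda>(a, b). \<phi> a i i' * \<psi> b j j') x)"
proof -
  let ?R = "C_circle_sub n" and ?T = "C_circle_sub m"
  have \<phi>l: "linear_functional ?R (\<lambda>a. \<phi> a i i')" if "i < k" "i' < k" for i i'
    using \<phi> that by (simp add: ucp_map_def)
  have \<psi>l: "linear_functional ?T (\<lambda>b. \<psi> b j j')" if "j < q" "j' < q" for j j'
    using \<psi> that by (simp add: ucp_map_def)
  have \<phi>p: "psd_on ({..<r} \<times> {..<k}) (\<lambda>(s, i) (t, j). \<phi> (A s t) i j)" if "A \<in> os_pos ?R r" for r A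
    using \<phi> that unfolding ucp_map_def by blast
  have \<psi>p: "psd_on ({..<r} \<times> {..<q}) (\<lambda>(s, i) (t, j). \<psi> (A s t) i j)" if "A \<in> os_pos ?T r" for r A
    using \<psi> that unfolding ucp_map_def by blast
  define M where "M j j' = (\<lambda>z. pm_eval (\<lambda>(a, b). a z * \<psi> b j j') x)" for j j'
  have M_mem: "M j j' \<in> trig_polys n" for j j'
    using slice_left(1)[OF function_system_C_circle_sub x] by (simp add: M_def)
  have "psd_on {..<q} (\<lambda>j j'. M j j' z)" if z: "z \<in> circle" for z
  proof -
    let ?r = "\<lambda>w. pm_eval (\<lambda>(a, b). a z * b w) x"
    have "?r \<in> os_cone ?T"
      using slice_right(1)[OF function_system_C_circle_sub x, of "\<lambda>a. a z"] pos z
      by (simp add: os_cone_C_circle_sub)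
    \<comment> \<open>The slice is a positive 1 by 1 matrix, so this uses \<open>\<psi>\<close> at
      the first matrix level; \<open>\<phi>\<close> is used below at level \<open>q\<close>.\<close>
    then have r: "psd_on ({..<1 :: nat} \<times> {..<q}) (\<lambda>(s, i) (t, j). \<psi> ?r i j)"
      unfolding os_cone_def mem_Collect_eq by (rule \<psi>p)
    have eq: "{..<q} = snd ` ({..<1 :: nat} \<times> {..<q})" by (auto simp: image_iff)
    have "psd_on {..<q} (\<psi> ?r)"
      by (rule psd_on_reindex[OF _ eq]) (use r in \<open>auto simp: inj_on_def split_def\<close>)
    moreover have "\<psi> ?r j j' = M j j' z" if "j < q" "j' < q" for j j'
      using slice_right(2)[OF function_system_C_circle_sub x \<psi>l[OF that], of "\<lambda>a. a z"]
      by (simp add: M_def)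
    ultimately show ?thesis
      unfolding psd_on_def by simp
  qed
  then have "M \<in> os_pos ?R q"
    using M_mem by (simp add: os_pos_C_circle_sub)
  then have M: "psd_on ({..<q} \<times> {..<k}) (\<lambda>(s, i) (t, j). \<phi> (M s t) i j)"
    by (rule \<phi>p)
  have \<phi>M: "\<phi> (M s t) i j = pm_eval (\<lambda>(a, b). \<phi> a i j * \<psi> b s t) x" if "i < k" "j < k" for i j s t
    unfolding M_def
    using slice_left(2)[OF function_system_C_circle_sub x \<phi>l[OF that], of "\<lambda>b. \<psi> b s t"] .
  \<comment> \<open>Applying \<open>\<phi>\<close> to the entries of \<open>M\<close> puts the index
    of \<open>\<psi>\<close> first; the swap restores the order of the tensor factors.\<close>
  have "psd_on ({..<k} \<times> {..<q}) (\<lambda>(i, s) (j, t). \<phi> (M s t) i j)"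
    by (rule psd_on_reindex[of prod.swap "{..<q} \<times> {..<k}"])
      (use M in \<open>simp_all add: split_def product_swap\<close>)
  then show ?thesis
    by (rule iffD1[OF psd_on_cong, rotated]) (auto simp: \<phi>M)
qed

lemma tensor_map_class:
  assumes "ucp_map R k \<phi>" "ucp_map T q \<psi>" "x \<in> tensor_free R T" "i < k" "i' < k" "j < q" "j' < q"
  shows "tensor_map \<phi> \<psi> (tensor_class R T x) (i, j) (i', j') = pm_eval (\<lambda>(a, b). \<phi> a i i' * \<psi> b j j') x"
  using assms by (simp add: tensor_map_def tensor_functional_class ucp_map_def)

lemma min_cone_eq: "min_cone (C_circle_sub n) (C_circle_sub m) = torus_cone n m"
proof (intro equalityI subsetI)
  fix X assume X: "X \<in> min_cone (C_circle_sub n) (C_circle_sub m)"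
  then obtain x where x: "x \<in> tensor_free (C_circle_sub n) (C_circle_sub m)"
    and Xx: "X = tensor_class (C_circle_sub n) (C_circle_sub m) x"
    unfolding min_cone_def by (blast elim: tensor_spaceE)
  have "0 \<le> pm_eval (\<lambda>(a, b). a z * b w) x" if "z \<in> circle" "w \<in> circle" for z w
  proof -
    note ucp = ucp_map_point[OF that(1), of n] ucp_map_point[OF that(2), of m]
    then have "psd_on ({..<1} \<times> {..<1}) (tensor_map (\<lambda>a _ _. a z) (\<lambda>b _ _. b w) X)"
      using X zero_less_one unfolding min_cone_def by blast
    from psd_on_diag[OF this, of "(0, 0)"] show ?thesis
      using tensor_map_class[OF ucp x, of 0 0 0 0] by (simp add: Xx)
  qed
  then show "X \<in> torus_cone n m"
    unfolding Xx by (rule torus_coneI[OF x])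
next
  fix X assume "X \<in> torus_cone n m"
  then obtain x where x: "x \<in> tensor_free (C_circle_sub n) (C_circle_sub m)"
    and Xx: "X = tensor_class (C_circle_sub n) (C_circle_sub m) x"
    and "\<forall>z\<in>circle. \<forall>w\<in>circle. 0 \<le> pm_eval (\<lambda>(a, b). a z * b w) x"
    unfolding torus_cone_def mem_Collect_eq by (elim exE conjE)
  then have pos: "0 \<le> pm_eval (\<lambda>(a, b). a z * b w) x" if "z \<in> circle" "w \<in> circle" for z w
    using that by simp
  show "X \<in> min_cone (C_circle_sub n) (C_circle_sub m)"
    unfolding min_cone_def
  proof (intro CollectI conjI allI impI)
    show "X \<in> tensor_space (C_circle_sub n) (C_circle_sub m)"
      unfolding Xx by (rule tensor_class_in_space[OF x])
    fix k q \<phi> \<psi>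
    assume u: "ucp_map (C_circle_sub n) k \<phi> \<and> ucp_map (C_circle_sub m) q \<psi>"
    then have "psd_on ({..<k} \<times> {..<q})
        (\<lambda>(i, j) (i', j'). pm_eval (\<lambda>(a, b). \<phi> a i i' * \<psi> b j j') x)"
      using ucp_tensor_torus[OF x pos] by blast
    then show "psd_on ({..<k} \<times> {..<q}) (tensor_map \<phi> \<psi> X)"
      unfolding Xx by (rule iffD2[OF psd_on_cong, rotated]) (use u x in \<open>auto simp: tensor_map_class\<close>)
  qed
qed

section \<open>The maximal cone\<close>

lemma pm_eval_compression:
  "pm_eval (\<lambda>(u, v). u z * v w) (compression k q \<delta> a b) =
    (\<Sum>(i, j)\<in>{..<k} \<times> {..<q}. \<Sum>(i', j')\<in>{..<k} \<times> {..<q}.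
      cnj (\<delta> (i, j)) * \<delta> (i', j') * (a i i' z * b j j' w))"
  by (simp add: compression_def split_def)

text \<open>Point evaluation turns the compression into a form of a Kronecker product of positive
  semidefinite matrices; then \<epsilon> tends to 0.\<close>

lemma max_cone_subset:
  assumes "n > 0" "m > 0"
  shows "max_cone (C_circle_sub n) (C_circle_sub m) \<subseteq> torus_cone n m"
proof
  let ?R = "C_circle_sub n" and ?T = "C_circle_sub m"
  fix X assume X: "X \<in> max_cone ?R ?T"
  then obtain x where x: "x \<in> tensor_free ?R ?T" and Xx: "X = tensor_class ?R ?T x"
    unfolding max_cone_def by (blast elim: tensor_spaceE)
  have "0 \<le> pm_eval (\<lambda>(a, b). a z * b w) x" if zw: "z \<in> circle" "w \<in> circle" for z w
  proof -
    have eps: "0 \<le> complex_of_real \<epsilon> + pm_eval (\<lambda>(a, b). a z * b w) x" if \<epsilon>: "\<epsilon> > 0" for \<epsilon>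
    proof -
      let ?u = "Poly_Mapping.single (os_unit ?R, os_unit ?T) (complex_of_real \<epsilon>)"
      have u: "?u \<in> tensor_free ?R ?T"
        \<comment> \<open>Here the positivity of \<open>n\<close> and \<open>m\<close> matters: it
          puts the constant function 1 into both spaces.\<close>
        by (rule tensor_free_single) (simp_all add: unit_in_trig_polys assms)
      obtain k q a b \<delta> where a: "a \<in> os_pos ?R k" and b: "b \<in> os_pos ?T q"
        and eq: "tensor_add (tensor_class ?R ?T ?u) X = tensor_class ?R ?T (compression k q \<delta> a b)"
        using X[unfolded max_cone_def, THEN CollectD, THEN conjunct2, rule_format, OF \<epsilon>] by blast
      have c: "compression k q \<delta> a b \<in> tensor_free ?R ?T"
        using a b by (intro tensor_free_compression) (auto simp: os_pos_C_circle_sub)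
      have "?u + x - compression k q \<delta> a b \<in> free_space.span (bilinear_relations ?R ?T)"
        using eq unfolding Xx tensor_add_class[OF u x] tensor_class_eq_iff[OF tensor_free_add[OF u x] c] .
      from pm_eval_span_relations[OF linear_functional_point[of n z] linear_functional_point[of m w] this]
      have "complex_of_real \<epsilon> + pm_eval (\<lambda>(a, b). a z * b w) x
          = pm_eval (\<lambda>(a, b). a z * b w) (compression k q \<delta> a b)"
        using zw by simp
      also have "0 \<le> \<dots>"
        unfolding pm_eval_compression
        using a b zw by (intro psd_on_kronecker_form) (auto simp: os_pos_C_circle_sub)
      finally show ?thesis .
    qed
    let ?F = "pm_eval (\<lambda>(a, b). a z * b w) x"
    have "Im ?F = 0" using eps[of 1] by (simp add: less_eq_complex_def)
    moreover have "0 \<le> Re ?F"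
    proof (rule field_le_epsilon)
      show "0 \<le> Re ?F + e" if "e > 0" for e
        using eps[OF that] by (simp add: less_eq_complex_def add.commute)
    qed
    ultimately show ?thesis by (simp add: less_eq_complex_def)
  qed
  then show "X \<in> torus_cone n m"
    unfolding Xx by (rule torus_coneI[OF x])
qed

lemma two_norm_le_of_torus_nonneg:
  assumes pos: "\<And>z. z \<in> circle \<Longrightarrow> 0 \<le> C * cnj z + B + A * z"
  shows "C = cnj A" "B = of_real (Re B)" "2 * cmod A \<le> Re B"
proof -
  have circ: "1 \<in> circle" "- 1 \<in> circle" "\<i> \<in> circle" by (auto simp: circle_def)
  show C: "C = cnj A" and B: "B = of_real (Re B)"
    \<comment> \<open>Vanishing imaginary parts at 1 and - 1 give real \<open>B\<close> and opposite
      imaginary parts of \<open>A\<close> and \<open>C\<close>; the point \<i> then gives equal real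
      parts.\<close>
    using pos[OF circ(1)] pos[OF circ(2)] pos[OF circ(3)]
    by (auto simp: less_eq_complex_def complex_eq_iff)
  show "2 * cmod A \<le> Re B"
  proof (cases "A = 0")
    case True
    then show ?thesis using pos[OF circ(1)] by (simp add: C less_eq_complex_def)
  next
    case False
    \<comment> \<open>The point of the circle that rotates \<open>A\<close> to
      \<open>- cmod A\<close>, where the expression is least.\<close>
    define z where "z = - cnj A / cmod A"
    have "z \<in> circle" using False by (simp add: circle_def z_def norm_divide)
    have "A * z = - (A * cnj A) / cmod A" by (simp add: z_def)
    then have "A * z = - of_real (cmod A)"
      using False unfolding complex_norm_square[symmetric] by (simp add: power2_eq_square)
    moreover have "C * cnj z = cnj (A * z)" by (simp add: C)
    ultimately show ?thesis
      using pos[OF \<open>z \<in> circle\<close>] by (simp add: less_eq_complex_def)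
  qed
qed

text \<open>
  An element of the tensor product has the values \<open>C w * cnj z + B w + A w * z\<close>. Positivity on the
  torus says that \<open>[[B / 2, A], [C, B / 2]]\<close> is pointwise positive semidefinite, and the values are
  the sum of the entries of its Schur product with the positive matrix \<open>[[1, z], [cnj z, 1]]\<close>.
\<close>

lemma torus_cone_subset_max:
  assumes "m > 0"
  shows "torus_cone 2 m \<subseteq> max_cone (C_circle_sub 2) (C_circle_sub m)"
proof
  let ?R = "C_circle_sub 2" and ?T = "C_circle_sub m"
  fix X assume "X \<in> torus_cone 2 m"
  then obtain x where x: "x \<in> tensor_free ?R ?T" and Xx: "X = tensor_class ?R ?T x"
    and "\<forall>z\<in>circle. \<forall>w\<in>circle. 0 \<le> pm_eval (\<lambda>(a, b). a z * b w) x"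
    unfolding torus_cone_def mem_Collect_eq by (elim exE conjE)
  then have pos: "0 \<le> pm_eval (\<lambda>(a, b). a z * b w) x" if "z \<in> circle" "w \<in> circle" for z w
    using that by simp
  obtain p q r where "\<forall>f\<in>trig_polys 2. \<forall>z\<in>circle. f z = p f * cnj z + q f + r f * z"
    using trig_polys_2_coefficients by (elim exE)
  then have pqr: "f z = p f * cnj z + q f + r f * z" if "f \<in> trig_polys 2" "z \<in> circle" for f z
    using that by simp
  define C where "C = (\<lambda>w. pm_eval (\<lambda>(a, b). p a * b w) x)"
  define B where "B = (\<lambda>w. pm_eval (\<lambda>(a, b). q a * b w) x)"
  define A where "A = (\<lambda>w. pm_eval (\<lambda>(a, b). r a * b w) x)"
  have mem: "A \<in> trig_polys m" "B \<in> trig_polys m" "C \<in> trig_polys m"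
    using slice_right(1)[OF function_system_C_circle_sub x] by (auto simp: A_def B_def C_def)
  have F: "pm_eval (\<lambda>(a, b). a z * b w) x = C w * cnj z + B w + A w * z" if "z \<in> circle" for z w
  proof -
    have "a \<in> trig_polys 2" if "(a, b) \<in> Poly_Mapping.keys x" for a b
      using x that by (auto simp: tensor_free_def)
    then have "pm_eval (\<lambda>(a, b). a z * b w) x = (\<Sum>u\<in>Poly_Mapping.keys x. Poly_Mapping.lookup x u *
        ((p (fst u) * cnj z + q (fst u) + r (fst u) * z) * snd u w))"
      unfolding pm_eval_def split_def using pqr[OF _ that] by (intro sum.cong refl) force
    also have "\<dots> = C w * cnj z + B w + A w * z"
      by (simp add: A_def B_def C_def pm_eval_def split_def sum_distrib_left
          sum_distrib_right sum.distrib algebra_simps)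
    finally show ?thesis .
  qed
  have "\<exists>k>0. \<exists>q>0. \<exists>a\<in>os_pos ?R k. \<exists>b\<in>os_pos ?T q. \<exists>\<delta>.
      tensor_add (tensor_class ?R ?T (Poly_Mapping.single (os_unit ?R, os_unit ?T) (complex_of_real \<epsilon>))) X
        = tensor_class ?R ?T (compression k q \<delta> a b)" if \<epsilon>: "\<epsilon> > 0" for \<epsilon> :: real
  proof -
    let ?one = "\<lambda>z. if z \<in> circle then 1 else (0 :: complex)"
    let ?u = "Poly_Mapping.single (os_unit ?R, os_unit ?T) (complex_of_real \<epsilon>)"
    \<comment> \<open>Half of \<open>B + \<epsilon>\<close>, because it occurs in both diagonal
      places against the constant 1.\<close>
    define H where "H = (\<lambda>w. 1 / 2 * (B + (\<lambda>w. of_real \<epsilon> * ?one w)) w)"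
    define a where "a i j = (if i = j then ?one else if i = (0 :: nat)
      then (\<lambda>z. if z \<in> circle then z powi 1 else 0) else (\<lambda>z. if z \<in> circle then z powi (- 1) else 0))"
      for i j
    define b where "b i j = (if i = j then H else if i = (0 :: nat) then A else C)" for i j
    \<comment> \<open>The sum of the vectors e_i \<otimes> e_i: compressing by it retains exactly
      the products \<open>a i j\<close> \<otimes> \<open>b i j\<close>, that is, the sum of the
      entries of the Schur product.\<close>
    define \<delta> :: "nat \<times> nat \<Rightarrow> complex" where "\<delta> = (\<lambda>(i, j). if i = j then 1 else 0)"
    have H: "H \<in> trig_polys m"
      unfolding H_def using mem(2) unit_in_trig_polys[OF assms]
      by (intro trig_polys_scale trig_polys_add)
    have a_mem: "a i j \<in> trig_polys 2" for i j
      using monomial_in_trig_polys[of 1 2] monomial_in_trig_polys[of "- 1" 2] unit_in_trig_polys[of 2]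
      by (simp add: a_def)
    have b_mem: "b i j \<in> trig_polys m" for i j
      using H mem by (simp add: b_def)
    have "a \<in> os_pos ?R 2"
      unfolding os_pos_C_circle_sub
    proof (intro conjI ballI allI impI a_mem)
      fix z assume z: "z \<in> circle"
      have "psd_on {..<2} (\<lambda>i j. if i = j then of_real (2 / 2) else if i = (0::nat) then z else cnj z)"
        by (rule psd_on_2x2) (use z in \<open>simp add: circle_def\<close>)
      moreover have "(\<lambda>i j. a i j z) = (\<lambda>i j. if i = j then of_real (2 / 2) else if i = (0::nat) then z else cnj z)"
        using z cnj_powi_circle[OF z, of 1] by (auto simp: a_def fun_eq_iff)
      ultimately show "psd_on {..<2} (\<lambda>i j. a i j z)" by (simp only:)
    qed
    moreover have "b \<in> os_pos ?T 2"
      unfolding os_pos_C_circle_sub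
    proof (intro conjI ballI allI impI b_mem)
      fix w assume w: "w \<in> circle"
      have "0 \<le> C w * cnj z + B w + A w * z" if "z \<in> circle" for z
        using pos[OF that w] by (simp add: F[OF that])
      note BC = two_norm_le_of_torus_nonneg[OF this]
      have "psd_on {..<2} (\<lambda>i j. if i = j then of_real ((Re (B w) + \<epsilon>) / 2)
          else if i = (0::nat) then A w else cnj (A w))"
        \<comment> \<open>The minimum over \<open>z\<close> gives
          \<open>2 * cmod (A w) \<le> Re (B w)\<close>, and adding \<epsilon> only enlarges the
          right side.\<close>
        by (rule psd_on_2x2) (use BC(3) \<epsilon> in simp)
      moreover have "(\<lambda>i j. b i j w) = (\<lambda>i j. if i = j then of_real ((Re (B w) + \<epsilon>) / 2)
          else if i = (0::nat) then A w else cnj (A w))"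
      proof -
        have "Im (B w) = 0" using BC(2) by (metis Im_complex_of_real)
        then have "H w = of_real ((Re (B w) + \<epsilon>) / 2)"
          using w by (simp add: H_def complex_eq_iff)
        then show ?thesis using BC(1) by (auto simp: b_def fun_eq_iff)
      qed
      ultimately show "psd_on {..<2} (\<lambda>i j. b i j w)" by (simp only:)
    qed
    moreover have "tensor_add (tensor_class ?R ?T ?u) X = tensor_class ?R ?T (compression 2 2 \<delta> a b)"
    proof -
      have u: "?u \<in> tensor_free ?R ?T"
        by (rule tensor_free_single) (simp_all add: unit_in_trig_polys assms)
      have c: "compression 2 2 \<delta> a b \<in> tensor_free ?R ?T"
        by (rule tensor_free_compression) (simp_all add: a_mem b_mem)
      show ?thesis
        unfolding Xx tensor_add_class[OF u x]
      proof (rule tensor_class_eqI[OF tensor_free_add[OF u x] c])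
        fix z w assume zw: "z \<in> circle" "w \<in> circle"
        have two: "{..<2} = {0, 1 :: nat}" by auto
        have "pm_eval (\<lambda>(a, b). a z * b w) (compression 2 2 \<delta> a b)
            = (\<Sum>i<2. \<Sum>j<2. a i j z * b i j w)"
          unfolding pm_eval_compression two by (simp add: \<delta>_def sum.cartesian_product[symmetric])
        \<comment> \<open>The diagonal contributes \<open>2 * H w = B w + \<epsilon>\<close>, the
          off-diagonal places \<open>z * A w\<close> and \<open>cnj z * C w\<close>.\<close>
        also have "\<dots> = of_real \<epsilon> + (C w * cnj z + B w + A w * z)"
          using zw cnj_powi_circle[OF zw(1), of 1]
          by (simp add: two a_def b_def H_def algebra_simps)
        finally show "pm_eval (\<lambda>(a, b). a z * b w) (?u + x) =
            pm_eval (\<lambda>(a, b). a z * b w) (compression 2 2 \<delta> a b)"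
          using zw by (simp add: F)
      qed
    qed
    ultimately show ?thesis by (intro exI[of _ 2] conjI) auto
  qed
  then show "X \<in> max_cone ?R ?T"
    unfolding max_cone_def Xx using tensor_class_in_space[OF x] by blast
qed

theorem theorem1p12:
  fixes n m :: nat
  assumes "n \<ge> 2" and "m \<ge> 2"
  shows "min_cone (C_circle_sub n) (C_circle_sub m) = sep_star_cone (C_circle_sub n) (C_circle_sub m)
       \<and> max_cone (C_circle_sub 2) (C_circle_sub m) = sep_star_cone (C_circle_sub 2) (C_circle_sub m)"
proof
  show "min_cone (C_circle_sub n) (C_circle_sub m) = sep_star_cone (C_circle_sub n) (C_circle_sub m)"
    by (simp add: min_cone_eq sep_star_cone_eq)
  show "max_cone (C_circle_sub 2) (C_circle_sub m) = sep_star_cone (C_circle_sub 2) (C_circle_sub m)"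
    unfolding sep_star_cone_eq
    using max_cone_subset[of 2 m] torus_cone_subset_max[of m] assms by (intro equalityI) simp_all
qed

end
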